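(* Fix $\lambda>m$. If $\mathbb E[\xi+\xi^{-1}+\nu^2]<\infty$, then almost surely $$\frac{C_n(\lambda)}{\mathbb E[C_n(\lambda)]}\longrightarrow W\qquad\text{as }n\to\infty.$$ If $\mathbb E[\xi^2+\xi^{-1}+\nu^3]<\infty$, then the limit $$\lim_{n\to\infty}\Big(\frac{\lambda}{m}\Big)^n\mathbb E[C_n(\lambda)]$$ exists and is strictly positive (and finite).
   Context: Let $\mathbf p=(p_k)_{k\ge0}$ be a probability distribution on the nonnegative integers with $p_0=0$ and finite mean $m=\sum_k kp_k>1$. Let $\mathbb T$ be a Galton–Watson tree with offspring distribution $\mathbf p$, rooted at $\varnothing$, and $\nu$ the number of children of the root. For a vertex $x$, $|x|$ is its depth and $\overleftarrow{x}$ its parent; $\mathbb T_n=\{x\in\mathbb T:|x|=n\}$; the edge $e=\{\overleftarrow x,x\}$ has depth $d(e)=|x|$. Let $\xi$ be a strictly positive random variable; conditionally on $\mathbb T$, $\{\xi(e)\}$ are i.i.d. copies of $\xi$. For $\lambda>0$, assign to each edge $e$ the resistance $\lambda^{d(e)}\xi(e)$, and let $C_n(\lambda)$ be the effective conductance in this network between $\varnothing$ and $\mathbb T_n$. $W=\lim_n m^{-n}\#\mathbb T_n$ (a.s. limit). *)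

theory Defs
  imports "HOL-Probability.Probability"
begin

text \<open>Ulam--Harris encoding. A vertex is a list of child indices; the vertex u has
  children u @ [i] for i < N u, where N u is the number of children of u.
  The parent of a non-root vertex v is butlast v, its depth is length v.
  X v is the weight xi(e) of the edge e joining butlast v to v.\<close>

definition gw_tree :: "(nat list \<Rightarrow> nat) \<Rightarrow> nat list set" where
  "gw_tree N = {u. \<forall>i < length u. u ! i < N (take i u)}"

definition gw_level :: "(nat list \<Rightarrow> nat) \<Rightarrow> nat \<Rightarrow> nat list set" where
  "gw_level N n = {u \<in> gw_tree N. length u = n}"

text \<open>Dirichlet energy of a potential f on the tree truncated at depth n, where the
  edge into v has resistance lam^(depth v) * X v (i.e. conductance its inverse).\<close>

definition dirichlet_energy ::
  "real \<Rightarrow> (nat list \<Rightarrow> nat) \<Rightarrow> (nat list \<Rightarrow> real) \<Rightarrow> nat \<Rightarrow> (nat list \<Rightarrow> real) \<Rightarrow> real" where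
  "dirichlet_energy lam N X n f =
     (\<Sum>v \<in> {v \<in> gw_tree N. 1 \<le> length v \<and> length v \<le> n}.
        (f (butlast v) - f v)^2 / (lam ^ length v * X v))"

text \<open>Effective conductance between the root and level n (Dirichlet principle).
  Edges below level n do not affect it (the potential can be taken 0 there).\<close>

definition eff_conductance ::
  "real \<Rightarrow> (nat list \<Rightarrow> nat) \<Rightarrow> (nat list \<Rightarrow> real) \<Rightarrow> nat \<Rightarrow> real" where
  "eff_conductance lam N X n =
     Inf {dirichlet_energy lam N X n f | f. f [] = 1 \<and> (\<forall>v \<in> gw_level N n. f v = 0)}"

end

theory Submission
  imports Defs
begin

text \<open>
  Let \<open>\<rho> = m / \<lambda>\<close> and let \<open>c\<^sub>n\<close> be the conductance to level \<open>n + 1\<close> divided by \<open>\<rho> ^ (n + 1)\<close>. The series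
  and parallel laws give \<open>c\<^sub>n = T g\<^sub>n\<close> and \<open>g\<^sub>n\<^sub>+\<^sub>1 = c\<^sub>n / (1 + \<xi> \<rho> ^ (n + 1) c\<^sub>n)\<close>, where \<open>T F\<close> is the sum of
  \<open>F\<close> over the subtrees at the children of the root, divided by \<open>m\<close>. The operator \<open>T\<close> preserves means
  and divides the second moment of a centred functional by \<open>m\<close>.

  As \<open>g\<^sub>n\<^sub>+\<^sub>1 \<le> c\<^sub>n\<close>, the means \<open>a\<^sub>n\<close> of \<open>c\<^sub>n\<close> decrease, by at most a multiple of \<open>\<rho> ^ n\<close> since \<open>c\<^sub>n\<close> is
  bounded in \<open>L\<^sup>2\<close>. Testing Thomson's principle on the uniform flow bounds \<open>a\<^sub>n\<close> away from 0. Finally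
  \<open>c\<^sub>j\<^sub>+\<^sub>k \<le> T ^ k c\<^sub>j\<close>, the mean of the difference being \<open>a\<^sub>j - a\<^sub>j\<^sub>+\<^sub>k\<close>, while \<open>T ^ k c\<^sub>j - a\<^sub>j W\<^sub>k = T ^ k (c\<^sub>j - a\<^sub>j)\<close>
  has second moment of order \<open>m ^ (- k)\<close>. Taking \<open>j\<close> and \<open>k\<close> close to \<open>n / 2\<close>, the distance of \<open>c\<^sub>n\<close> to
  \<open>a\<^sub>j W\<^sub>k\<close> is summable in \<open>L\<^sup>1\<close>, which gives almost sure convergence.
\<close>

section \<open>Conductances of finite trees\<close>

text \<open>Polymorphic, so that one shift serves offspring numbers, weights, potentials and whole
  configurations.\<close>

definition subtree :: "nat \<Rightarrow> (nat list \<Rightarrow> 'b) \<Rightarrow> nat list \<Rightarrow> 'b" where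
  "subtree i z = (\<lambda>u. z (i # u))"

lemma subtree_Nil [simp]: "subtree i z [] = z [i]"
  by (simp add: subtree_def)

lemma fst_subtree [simp]: "(\<lambda>u. fst (subtree i z u)) = subtree i (\<lambda>u. fst (z u))"
  and snd_subtree [simp]: "(\<lambda>u. snd (subtree i z u)) = subtree i (\<lambda>u. snd (z u))"
  by (simp_all add: subtree_def)

section \<open>Levels, edges and energy decomposed along the children of the root\<close>

lemma gw_tree_Nil [simp]: "[] \<in> gw_tree N"
  by (simp add: gw_tree_def)

lemma gw_tree_Cons [simp]: "i # u \<in> gw_tree N \<longleftrightarrow> i < N [] \<and> u \<in> gw_tree (subtree i N)"
  by (auto simp: gw_tree_def All_less_Suc2 subtree_def)

lemma gw_level_0 [simp]: "gw_level N 0 = {[]}"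
  by (auto simp: gw_level_def)

lemma Cons_in_gw_level [simp]:
  "i # u \<in> gw_level N (Suc n) \<longleftrightarrow> i < N [] \<and> u \<in> gw_level (subtree i N) n"
  by (auto simp: gw_level_def)

lemma gw_level_Suc: "gw_level N (Suc n) = (\<Union>i<N []. (#) i ` gw_level (subtree i N) n)"
proof (rule set_eqI)
  fix v show "v \<in> gw_level N (Suc n) \<longleftrightarrow> v \<in> (\<Union>i<N []. (#) i ` gw_level (subtree i N) n)"
    by (cases v) (auto simp: gw_level_def)
qed

lemma finite_gw_level: "finite (gw_level N n)"
  by (induction n arbitrary: N) (auto simp: gw_level_Suc)

lemma card_gw_level_Suc: "card (gw_level N (Suc n)) = (\<Sum>i<N []. card (gw_level (subtree i N) n))"
proof -
  have "card (gw_level N (Suc n)) = (\<Sum>i<N []. card ((#) i ` gw_level (subtree i N) n))"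
    unfolding gw_level_Suc by (rule card_UN_disjoint) (auto simp: finite_gw_level)
  also have "\<dots> = (\<Sum>i<N []. card (gw_level (subtree i N) n))"
    by (intro sum.cong refl card_image) auto
  finally show ?thesis .
qed

text \<open>An edge is named by its lower endpoint; this is the index set of the sum in
  \<open>dirichlet_energy\<close>.\<close>

definition gw_edges :: "(nat list \<Rightarrow> nat) \<Rightarrow> nat \<Rightarrow> nat list set" where
  "gw_edges N n = {v \<in> gw_tree N. 1 \<le> length v \<and> length v \<le> n}"

lemma gw_edges_0 [simp]: "gw_edges N 0 = {}"
  by (auto simp: gw_edges_def)

lemma gw_edges_Suc: "gw_edges N (Suc n) = (\<Union>i<N []. (#) i ` insert [] (gw_edges (subtree i N) n))"
proof (rule set_eqI)
  fix v
  have *: "v \<noteq> [] \<longleftrightarrow> Suc 0 \<le> length v" for v :: "nat list"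
    by (cases v) auto
  show "v \<in> gw_edges N (Suc n) \<longleftrightarrow> v \<in> (\<Union>i<N []. (#) i ` insert [] (gw_edges (subtree i N) n))"
    by (cases v) (auto simp: gw_edges_def image_iff *)
qed

lemma finite_gw_edges: "finite (gw_edges N n)"
  by (induction n arbitrary: N) (auto simp: gw_edges_Suc)

lemma dirichlet_energy_0 [simp]: "dirichlet_energy lam N X 0 f = 0"
  using gw_edges_0[of N] by (simp add: dirichlet_energy_def gw_edges_def)

text \<open>An edge of the subtree at a child lies one level deeper in the whole tree, which costs
  one factor \<open>lam\<close>; the edge to the child itself has resistance
  \<open>lam * X [i]\<close>. Hence the common division by \<open>lam\<close>.\<close>

lemma dirichlet_energy_Suc:
  "dirichlet_energy lam N X (Suc n) f =
     (\<Sum>i<N []. (f [] - f [i])\<^sup>2 / X [i]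
        + dirichlet_energy lam (subtree i N) (subtree i X) n (subtree i f)) / lam"
proof -
  let ?t = "\<lambda>N X f v. (f (butlast v) - f v)\<^sup>2 / (lam ^ length v * X v)"
  have "dirichlet_energy lam N X (Suc n) f = sum (?t N X f) (gw_edges N (Suc n))"
    by (simp add: dirichlet_energy_def gw_edges_def)
  also have "\<dots> = (\<Sum>i<N []. sum (?t N X f) ((#) i ` insert [] (gw_edges (subtree i N) n)))"
    unfolding gw_edges_Suc by (rule sum.UNION_disjoint) (auto simp: finite_gw_edges)
  also have "\<dots> = (\<Sum>i<N []. ((f [] - f [i])\<^sup>2 / X [i]
        + dirichlet_energy lam (subtree i N) (subtree i X) n (subtree i f)) / lam)"
  proof (rule sum.cong[OF refl])
    fix i
    have "sum (?t N X f) ((#) i ` insert [] (gw_edges (subtree i N) n))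
        = (\<Sum>v\<in>insert [] (gw_edges (subtree i N) n). ?t N X f (i # v))"
      by (subst sum.reindex) (auto simp: inj_on_def)
    also have "\<dots> = ?t N X f [i] + (\<Sum>v\<in>gw_edges (subtree i N) n. ?t N X f (i # v))"
      by (subst sum.insert) (auto simp: finite_gw_edges, auto simp: gw_edges_def)
    also have "(\<Sum>v\<in>gw_edges (subtree i N) n. ?t N X f (i # v))
        = (\<Sum>v\<in>gw_edges (subtree i N) n. ?t (subtree i N) (subtree i X) (subtree i f) v / lam)"
      by (intro sum.cong refl) (auto simp: gw_edges_def field_simps subtree_def)
    also have "\<dots> = dirichlet_energy lam (subtree i N) (subtree i X) n (subtree i f) / lam"
      by (simp add: dirichlet_energy_def gw_edges_def sum_divide_distrib)
    finally show "sum (?t N X f) ((#) i ` insert [] (gw_edges (subtree i N) n))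
       = ((f [] - f [i])\<^sup>2 / X [i]
        + dirichlet_energy lam (subtree i N) (subtree i X) n (subtree i f)) / lam"
      by (simp add: add_divide_distrib mult.commute)
  qed
  finally show ?thesis by (simp add: sum_divide_distrib)
qed

section \<open>Series-parallel recursion and the Dirichlet principle\<close>

type_synonym config = "nat list \<Rightarrow> nat \<times> real"

text \<open>\<^term>\<open>branch_cond lam n z\<close> is the conductance of the tree truncated at depth n when it is
  entered through an additional edge of resistance \<open>snd (z [])\<close> above its root.\<close>

primrec branch_cond :: "real \<Rightarrow> nat \<Rightarrow> config \<Rightarrow> real" where
  "branch_cond lam 0 z = 1 / snd (z [])"
| "branch_cond lam (Suc n) z =
     (let c = (\<Sum>i<fst (z []). branch_cond lam n (subtree i z)) / lam in c / (1 + snd (z []) * c))"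

text \<open>The parallel law. The index is shifted: this is the conductance from the root to level
  \<open>n + 1\<close>.\<close>

definition root_cond :: "real \<Rightarrow> nat \<Rightarrow> config \<Rightarrow> real" where
  "root_cond lam n z = (\<Sum>i<fst (z []). branch_cond lam n (subtree i z)) / lam"

lemma branch_cond_Suc:
  "branch_cond lam (Suc n) z = root_cond lam n z / (1 + snd (z []) * root_cond lam n z)"
  by (simp add: root_cond_def Let_def)

text \<open>The almost sure event on which all deterministic estimates are carried out.\<close>

definition pos_config :: "config \<Rightarrow> bool" where
  "pos_config z \<longleftrightarrow> (\<forall>u. 0 < snd (z u))"

lemma pos_config_subtree [intro]: "pos_config z \<Longrightarrow> pos_config (subtree i z)"
  by (simp add: pos_config_def subtree_def)

lemma pos_config_root: "pos_config z \<Longrightarrow> 0 < snd (z [])"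
  by (simp add: pos_config_def)

lemma branch_cond_nonneg:
  assumes "0 < lam" "pos_config z"
  shows "0 \<le> branch_cond lam n z"
  using assms(2)
proof (induction n arbitrary: z)
  case 0
  then show ?case using pos_config_root[OF 0] by simp
next
  case (Suc n)
  have "0 \<le> root_cond lam n z"
    using assms(1) Suc unfolding root_cond_def
    by (intro divide_nonneg_pos sum_nonneg Suc.IH) auto
  then show ?case
    using pos_config_root[OF Suc.prems] by (simp add: branch_cond_Suc del: branch_cond.simps)
qed

lemma root_cond_nonneg:
  assumes "0 < lam" "pos_config z"
  shows "0 \<le> root_cond lam n z"
  using assms unfolding root_cond_def
  by (intro divide_nonneg_pos sum_nonneg branch_cond_nonneg) auto

text \<open>Completing the square in \<open>b\<close>, the potential at the junction of a resistance
  \<open>x\<close> and a conductance \<open>c\<close> in series, with potential \<open>a\<close> at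
  the free end of \<open>x\<close> and 0 at the other end of \<open>c\<close>. The last square
  vanishes at \<open>b = a / (1 + x * c)\<close>.\<close>

lemma series_law_identity:
  fixes a b c x :: real
  assumes "0 < x" "0 \<le> c"
  shows "(a - b)\<^sup>2 / x + c * b\<^sup>2 = a\<^sup>2 * (c / (1 + x * c)) + ((1 + x * c) * b - a)\<^sup>2 / (x * (1 + x * c))"
proof -
  have "1 + x * c > 0" using assms by (simp add: add_pos_nonneg)
  then have "1 + x * c \<noteq> 0" "x \<noteq> 0" using assms by auto
  then show ?thesis by (simp add: divide_simps) algebra
qed

lemma series_law_le:
  fixes a b c x :: real
  assumes "0 < x" "0 \<le> c"
  shows "a\<^sup>2 * (c / (1 + x * c)) \<le> (a - b)\<^sup>2 / x + c * b\<^sup>2"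
  unfolding series_law_identity[OF assms] using assms by simp

lemma series_law_eq:
  fixes a c x :: real
  assumes "0 < x" "0 \<le> c"
  shows "(a - a / (1 + x * c))\<^sup>2 / x + c * (a / (1 + x * c))\<^sup>2 = a\<^sup>2 * (c / (1 + x * c))"
proof -
  have "1 + x * c > 0" using assms by (simp add: add_pos_nonneg)
  then show ?thesis unfolding series_law_identity[OF assms] by simp
qed

abbreviation energy :: "real \<Rightarrow> config \<Rightarrow> nat \<Rightarrow> (nat list \<Rightarrow> real) \<Rightarrow> real" where
  "energy lam z \<equiv> dirichlet_energy lam (\<lambda>u. fst (z u)) (\<lambda>u. snd (z u))"

lemma energy_Suc:
  "energy lam z (Suc n) f =
     (\<Sum>i<fst (z []). (f [] - f [i])\<^sup>2 / snd (z [i]) + energy lam (subtree i z) n (subtree i f)) / lam"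
  by (simp add: dirichlet_energy_Suc)

text \<open>One half of the Dirichlet principle. The potential \<open>a\<close> above the additional
  edge stays arbitrary because, in the induction, \<open>f []\<close> plays its role for the child
  subtrees; the series law then removes the edge above the root.\<close>

lemma branch_cond_le_energy:
  assumes "0 < lam" "pos_config z" "\<And>v. v \<in> gw_level (\<lambda>u. fst (z u)) n \<Longrightarrow> f v = 0"
  shows "a\<^sup>2 * branch_cond lam n z \<le> (a - f [])\<^sup>2 / snd (z []) + energy lam z n f"
  using assms(2-)
proof (induction n arbitrary: z f a)
  case 0
  then show ?case by simp
next
  case (Suc n)
  have IH: "(f [])\<^sup>2 * branch_cond lam n (subtree i z)
      \<le> (f [] - f [i])\<^sup>2 / snd (z [i]) + energy lam (subtree i z) n (subtree i f)"
    if "i < fst (z [])" for i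
  proof -
    have "(f [])\<^sup>2 * branch_cond lam n (subtree i z)
      \<le> (f [] - subtree i f [])\<^sup>2 / snd (subtree i z []) + energy lam (subtree i z) n (subtree i f)"
      using that Suc.prems(1)
      by (intro Suc.IH) (auto intro!: Suc.prems(2) simp: subtree_def[of _ f])
    then show ?thesis by simp
  qed
  have "root_cond lam n z * (f [])\<^sup>2 \<le> energy lam z (Suc n) f"
    unfolding energy_Suc root_cond_def using assms(1) IH
    by (auto simp: mult.commute[of _ "(f [])\<^sup>2"] sum_distrib_left
        intro!: divide_right_mono sum_mono)
  then show ?case
    using series_law_le[OF pos_config_root root_cond_nonneg, OF Suc.prems(1) assms(1) Suc.prems(1),
        of a n "f []"]
    by (simp add: branch_cond_Suc del: branch_cond.simps)
qed

text \<open>The other half: put the optimal potential of the series law at the root and glue below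
  it the minimisers of the child subtrees.\<close>

lemma branch_cond_attained:
  assumes "0 < lam" "pos_config z"
  shows "\<exists>f. (\<forall>v\<in>gw_level (\<lambda>u. fst (z u)) n. f v = 0) \<and>
     (a - f [])\<^sup>2 / snd (z []) + energy lam z n f = a\<^sup>2 * branch_cond lam n z"
  using assms(2)
proof (induction n arbitrary: z a)
  case 0
  show ?case by (rule exI[of _ "\<lambda>_. 0"]) simp
next
  case (Suc n)
  \<comment> \<open>The minimiser in the series law.\<close>
  define b where "b = a / (1 + snd (z []) * root_cond lam n z)"
  have "\<exists>f. (\<forall>v\<in>gw_level (\<lambda>u. fst (subtree i z u)) n. f v = 0) \<and>
     (b - f [])\<^sup>2 / snd (subtree i z []) + energy lam (subtree i z) n f
       = b\<^sup>2 * branch_cond lam n (subtree i z)" for i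
    by (rule Suc.IH) (use Suc.prems in auto)
  then obtain F where F: "\<And>i v. v \<in> gw_level (\<lambda>u. fst (subtree i z u)) n \<Longrightarrow> F i v = 0"
    "\<And>i. (b - F i [])\<^sup>2 / snd (subtree i z []) + energy lam (subtree i z) n (F i)
       = b\<^sup>2 * branch_cond lam n (subtree i z)"
    by metis
  define f where "f v = (case v of [] \<Rightarrow> b | i # u \<Rightarrow> F i u)" for v
  have fb: "f [] = b" by (simp add: f_def)
  have sf: "subtree i f = F i" for i by (simp add: f_def subtree_def)
  have "f v = 0" if "v \<in> gw_level (\<lambda>u. fst (z u)) (Suc n)" for v
    using that by (cases v) (auto simp: f_def gw_level_def intro!: F(1))
  moreover have "energy lam z (Suc n) f = root_cond lam n z * b\<^sup>2"
    using F(2) unfolding energy_Suc root_cond_def sf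
    by (simp add: f_def sum_distrib_right mult.commute[of "b\<^sup>2"])
  ultimately show ?case
    using series_law_eq[OF pos_config_root root_cond_nonneg, OF Suc.prems assms(1) Suc.prems, of a n]
    by (intro exI[of _ f]) (simp add: branch_cond_Suc b_def[symmetric] fb del: branch_cond.simps)
qed

text \<open>The root is held at potential 1 with no edge above it, so every child branch is an
  instance of the two preceding lemmas with \<open>a = 1\<close>. Gluing the minimisers turns the
  infimum into a minimum.\<close>

lemma eff_conductance_eq_root_cond:
  assumes "0 < lam" "pos_config z"
  shows "eff_conductance lam (\<lambda>u. fst (z u)) (\<lambda>u. snd (z u)) (Suc n) = root_cond lam n z"
proof -
  let ?L = "gw_level (\<lambda>u. fst (z u)) (Suc n)"
  have lower: "root_cond lam n z \<le> energy lam z (Suc n) f"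
    if f: "f [] = 1" "\<forall>v\<in>?L. f v = 0" for f
  proof -
    have "1\<^sup>2 * branch_cond lam n (subtree i z)
        \<le> (1 - subtree i f [])\<^sup>2 / snd (subtree i z []) + energy lam (subtree i z) n (subtree i f)"
      if "i < fst (z [])" for i
      using assms f(2) that
      by (intro branch_cond_le_energy) (auto simp: subtree_def[of _ f])
    then show ?thesis
      unfolding energy_Suc root_cond_def using f(1) assms(1)
      by (intro divide_right_mono sum_mono) auto
  qed
  have "\<exists>f. (\<forall>v\<in>gw_level (\<lambda>u. fst (subtree i z u)) n. f v = 0) \<and>
     (1 - f [])\<^sup>2 / snd (subtree i z []) + energy lam (subtree i z) n f
       = 1\<^sup>2 * branch_cond lam n (subtree i z)" for i
    by (rule branch_cond_attained) (use assms in auto)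
  then obtain F where F: "\<And>i v. v \<in> gw_level (\<lambda>u. fst (subtree i z u)) n \<Longrightarrow> F i v = 0"
    "\<And>i. (1 - F i [])\<^sup>2 / snd (subtree i z []) + energy lam (subtree i z) n (F i)
       = branch_cond lam n (subtree i z)"
    by (simp only: one_power2 mult_1) metis
  define f where "f v = (case v of [] \<Rightarrow> 1 | i # u \<Rightarrow> F i u)" for v
  have sf: "subtree i f = F i" for i by (simp add: f_def subtree_def)
  have f0: "f v = 0" if "v \<in> ?L" for v
    using that by (cases v) (auto simp: f_def gw_level_def intro!: F(1))
  have f1: "energy lam z (Suc n) f = root_cond lam n z"
    using F(2) unfolding energy_Suc root_cond_def sf by (simp add: f_def)
  show ?thesis
    unfolding eff_conductance_def
    by (rule cInf_eq_minimum) (use lower f0 f1 in \<open>auto intro!: exI[of _ f] simp: f_def\<close>)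
qed

section \<open>The law of the weighted tree and its subtrees\<close>

lemma measurable_subtree [measurable]:
  "subtree i \<in> PiM UNIV (\<lambda>_. B) \<rightarrow>\<^sub>M PiM UNIV (\<lambda>_. B)"
  unfolding subtree_def by (rule measurable_PiM_single') (auto simp: space_PiM PiE_iff)

lemma distr_subtree:
  assumes "prob_space B"
  shows "distr (PiM UNIV (\<lambda>_. B)) (PiM UNIV (\<lambda>_. B)) (subtree i) = PiM UNIV (\<lambda>_. B)"
  using distr_PiM_reindex[of UNIV "\<lambda>_. B" "\<lambda>u. i # u" UNIV] assms
  by (simp add: subtree_def[abs_def] inj_on_def restrict_def)

lemma indep_vars_coordinates:
  assumes B: "prob_space B"
  shows "prob_space.indep_vars (PiM (UNIV :: 'i set) (\<lambda>_. B)) (\<lambda>_. B) (\<lambda>u z. z u) UNIV"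
proof -
  interpret prob_space "PiM (UNIV :: 'i set) (\<lambda>_. B)" by (rule prob_space_PiM) (rule B)
  show ?thesis
    by (subst indep_vars_iff_distr_eq_PiM)
       (auto simp: distr_PiM_component[of UNIV "\<lambda>_. B", OF B] restrict_UNIV distr_id)
qed

text \<open>The subtrees at different children read disjoint sets of coordinates. All labels
  \<open>i\<close> are used, including those beyond the number of children, so the family does not
  depend on the root label.\<close>

lemma distr_subtrees:
  assumes B: "prob_space B"
  defines "P \<equiv> PiM (UNIV :: nat list set) (\<lambda>_. B)"
  shows "distr P (PiM UNIV (\<lambda>_. P)) (\<lambda>z i. subtree i z) = PiM UNIV (\<lambda>_. P)"
proof -
  interpret prob_space P unfolding P_def by (rule prob_space_PiM) (rule B)
  let ?K = "\<lambda>i::nat. range (\<lambda>u. i # u)"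
  have "indep_vars (\<lambda>i. PiM (?K i) (\<lambda>_. B)) (\<lambda>i z. restrict (\<lambda>u. z u) (?K i)) UNIV"
    by (rule indep_vars_restrict[OF indep_vars_coordinates[where 'i = "nat list", OF B, folded P_def]])
       (auto simp: disjoint_family_on_def)
  then have "indep_vars (\<lambda>_. P) (\<lambda>i z. subtree i (restrict (\<lambda>u. z u) (?K i))) UNIV"
  proof (rule indep_vars_compose2)
    fix i
    show "subtree i \<in> PiM (?K i) (\<lambda>_. B) \<rightarrow>\<^sub>M P"
      unfolding subtree_def P_def by (rule measurable_PiM_single') (auto simp: space_PiM PiE_iff)
  qed
  moreover have "subtree i (restrict (\<lambda>u. z u) (?K i)) = subtree i z" for i and z :: "nat list \<Rightarrow> 'a"
    by (auto simp: subtree_def)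
  ultimately have "indep_vars (\<lambda>_. P) subtree UNIV" by simp
  then show ?thesis
    by (subst (asm) indep_vars_iff_distr_eq_PiM)
       (auto simp: P_def distr_subtree B restrict_UNIV)
qed

text \<open>Again by disjoint coordinates: the pair uses \<open>[]\<close> on one side and the
  nonempty lists on the other.\<close>

lemma distr_root_subtrees:
  assumes B: "prob_space B"
  defines "P \<equiv> PiM (UNIV :: nat list set) (\<lambda>_. B)"
  shows "distr P (B \<Otimes>\<^sub>M PiM UNIV (\<lambda>_. P)) (\<lambda>z. (z [], \<lambda>i. subtree i z)) = B \<Otimes>\<^sub>M PiM UNIV (\<lambda>_. P)"
proof -
  interpret prob_space P unfolding P_def by (rule prob_space_PiM) (rule B)
  let ?R = "- {[]} :: nat list set"
  let ?X = "\<lambda>z. restrict (\<lambda>u. z u) {[]} :: nat list \<Rightarrow> 'a" and ?Y = "\<lambda>z. restrict (\<lambda>u. z u) ?R :: nat list \<Rightarrow> 'a"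
  let ?S = "PiM {[]} (\<lambda>_. B)" and ?T = "PiM ?R (\<lambda>_. B)" and ?Q = "PiM (UNIV :: nat set) (\<lambda>_. P)"
  let ?f = "\<lambda>y :: nat list \<Rightarrow> 'a. y []" and ?g = "\<lambda>(y :: nat list \<Rightarrow> 'a) i. subtree i y"
  have ind: "indep_var ?S ?X ?T ?Y"
    by (rule indep_var_restrict[OF indep_vars_coordinates[where 'i = "nat list", OF B, folded P_def]]) auto
  have X [measurable]: "?X \<in> P \<rightarrow>\<^sub>M ?S" and Y [measurable]: "?Y \<in> P \<rightarrow>\<^sub>M ?T"
    using ind unfolding indep_var_distribution_eq by auto
  have f [measurable]: "?f \<in> ?S \<rightarrow>\<^sub>M B" by measurable
  have "subtree i \<in> PiM ?R (\<lambda>_. B) \<rightarrow>\<^sub>M P" for i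
    unfolding subtree_def P_def by (rule measurable_PiM_single') (auto simp: space_PiM PiE_iff)
  then have g [measurable]: "?g \<in> ?T \<rightarrow>\<^sub>M ?Q"
    by (intro measurable_PiM_single') (auto dest: measurable_space)
  have gY: "?g (?Y z) = ?g z" for z
    by (auto simp: subtree_def)
  have PX: "prob_space (distr P ?S ?X)" and PY: "prob_space (distr P ?T ?Y)"
    by (auto intro!: prob_space_distr)
  have *: "prob_space (distr (distr P ?T ?Y) ?Q ?g)"
    by (intro prob_space.prob_space_distr PY) simp
  have "distr P (B \<Otimes>\<^sub>M ?Q) (\<lambda>z. (z [], \<lambda>i. subtree i z)) =
      distr (distr P (?S \<Otimes>\<^sub>M ?T) (\<lambda>z. (?X z, ?Y z))) (B \<Otimes>\<^sub>M ?Q) (\<lambda>(x, y). (?f x, ?g y))"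
    by (subst distr_distr) (auto simp: comp_def gY)
  also have "\<dots> = distr (distr P ?S ?X \<Otimes>\<^sub>M distr P ?T ?Y) (B \<Otimes>\<^sub>M ?Q) (\<lambda>(x, y). (?f x, ?g y))"
    using ind[unfolded indep_var_distribution_eq] by simp
  also have "\<dots> = distr (distr P ?S ?X) B ?f \<Otimes>\<^sub>M distr (distr P ?T ?Y) ?Q ?g"
    by (rule pair_measure_distr[symmetric])
       (auto intro!: prob_space_imp_sigma_finite *)
  also have "distr (distr P ?S ?X) B ?f = B"
    using distr_PiM_component[of UNIV "\<lambda>_. B" "[] :: nat list"] B
    by (subst distr_distr) (auto simp: comp_def P_def)
  also have "distr (distr P ?T ?Y) ?Q ?g = ?Q"
    using distr_subtrees[OF B, folded P_def]
    by (subst distr_distr) (auto simp: comp_def gY)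
  finally show ?thesis .
qed

text \<open>Fubini on indicators. The reordering isolates the weight at the root, so that it can be
  integrated separately from the offspring number and the subtrees.\<close>

lemma distr_pair_swap_factor:
  assumes "prob_space A" "prob_space D" "prob_space Q"
  shows "distr ((A \<Otimes>\<^sub>M D) \<Otimes>\<^sub>M Q) (D \<Otimes>\<^sub>M (A \<Otimes>\<^sub>M Q)) (\<lambda>x. (snd (fst x), (fst (fst x), snd x))) = D \<Otimes>\<^sub>M (A \<Otimes>\<^sub>M Q)"
    (is "distr ?L ?R ?f = ?R")
proof (rule measure_eqI)
  interpret A: prob_space A by fact
  interpret D: prob_space D by fact
  interpret Q: prob_space Q by fact
  interpret AD: pair_prob_space A D ..
  interpret AQ: pair_prob_space A Q ..
  fix S assume "S \<in> sets (distr ?L ?R ?f)"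
  then have S [measurable]: "S \<in> sets ?R" by simp
  have "emeasure (distr ?L ?R ?f) S = (\<integral>\<^sup>+x. indicator S (?f x) \<partial>?L)"
    by (subst nn_integral_indicator[symmetric], simp, subst nn_integral_distr) simp_all
  also have "\<dots> = (\<integral>\<^sup>+y. \<integral>\<^sup>+q. indicator S (snd y, (fst y, q)) \<partial>Q \<partial>(A \<Otimes>\<^sub>M D))"
    by (subst Q.nn_integral_fst[symmetric]) (auto simp: split_beta')
  also have "\<dots> = (\<integral>\<^sup>+d. \<integral>\<^sup>+a. \<integral>\<^sup>+q. indicator S (d, (a, q)) \<partial>Q \<partial>A \<partial>D)"
    by (subst AD.nn_integral_snd[symmetric]) auto
  also have "\<dots> = (\<integral>\<^sup>+d. \<integral>\<^sup>+y. indicator S (d, y) \<partial>(A \<Otimes>\<^sub>M Q) \<partial>D)"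
    by (intro nn_integral_cong, subst Q.nn_integral_fst[symmetric]) auto
  also have "\<dots> = emeasure ?R S"
    by (subst AQ.nn_integral_fst) auto
  finally show "emeasure (distr ?L ?R ?f) S = emeasure ?R S" .
qed simp

section \<open>Moments of sums of independent copies\<close>

lemma (in prob_space)
  fixes F :: "'a \<Rightarrow> real"
  assumes F: "integrable M F"
  shows integrable_component: "integrable (PiM UNIV (\<lambda>_. M)) (\<lambda>x. F (x i))"
    and integral_component: "(\<integral>x. F (x i) \<partial>PiM UNIV (\<lambda>_. M)) = integral\<^sup>L M F"
proof -
  have *: "distr (PiM UNIV (\<lambda>_. M)) M (\<lambda>x. x i) = M"
    by (rule distr_PiM_component) (auto intro: prob_space_axioms)
  show "integrable (PiM UNIV (\<lambda>_. M)) (\<lambda>x. F (x i))"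
    using F by (subst (asm) *[symmetric], subst (asm) integrable_distr_eq) auto
  show "(\<integral>x. F (x i) \<partial>PiM UNIV (\<lambda>_. M)) = integral\<^sup>L M F"
    using F by (subst (2) *[symmetric], subst integral_distr) auto
qed

lemma (in prob_space) integral_component_mult:
  fixes F :: "'a \<Rightarrow> real" and i j :: nat
  assumes F: "integrable M F" and ij: "i \<noteq> j"
  shows "integrable (PiM UNIV (\<lambda>_. M)) (\<lambda>x. F (x i) * F (x j))"
    and "(\<integral>x. F (x i) * F (x j) \<partial>PiM UNIV (\<lambda>_. M)) = (integral\<^sup>L M F)\<^sup>2"
proof -
  interpret Q: prob_space "PiM (UNIV :: nat set) (\<lambda>_. M)"
    by (rule prob_space_PiM) (rule prob_space_axioms)
  have "Q.indep_vars (\<lambda>_. M) (\<lambda>i x. x i) {i, j}"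
    by (rule Q.indep_vars_subset[OF indep_vars_coordinates[OF prob_space_axioms]]) simp
  then have ind: "Q.indep_vars (\<lambda>_. borel) (\<lambda>i x. F (x i)) {i, j}"
    by (rule Q.indep_vars_compose2) (use F in auto)
  show "integrable (PiM UNIV (\<lambda>_. M)) (\<lambda>x. F (x i) * F (x j))"
    using Q.indep_vars_integrable[OF _ ind integrable_component[OF F]] ij by simp
  show "(\<integral>x. F (x i) * F (x j) \<partial>PiM UNIV (\<lambda>_. M)) = (integral\<^sup>L M F)\<^sup>2"
    using Q.indep_vars_lebesgue_integral[OF _ ind integrable_component[OF F]] ij
    by (simp add: power2_eq_square integral_component[OF F])
qed

lemma (in prob_space) integral_sum_components_square:
  fixes F :: "'a \<Rightarrow> real" and k :: nat
  assumes F: "integrable M F" and F2: "integrable M (\<lambda>x. (F x)\<^sup>2)"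
  shows "integrable (PiM UNIV (\<lambda>_. M)) (\<lambda>x. (\<Sum>i<k. F (x i))\<^sup>2)"
    and "(\<integral>x. (\<Sum>i<k. F (x i))\<^sup>2 \<partial>PiM UNIV (\<lambda>_. M))
      = real k * (\<integral>x. (F x)\<^sup>2 \<partial>M) + (real k ^ 2 - real k) * (integral\<^sup>L M F)\<^sup>2"
proof -
  let ?Q = "PiM (UNIV :: nat set) (\<lambda>_. M)"
  have sq: "(\<Sum>i<k. F (x i))\<^sup>2 = (\<Sum>i<k. \<Sum>j<k. F (x i) * F (x j))" for x :: "nat \<Rightarrow> 'a"
    by (simp add: power2_eq_square sum_product)
  have *: "integrable ?Q (\<lambda>x. F (x i) * F (x j))" for i j
    using integral_component_mult(1)[OF F, of i j] integrable_component[OF F2, of i]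
    by (cases "i = j") (auto simp: power2_eq_square)
  show "integrable ?Q (\<lambda>x. (\<Sum>i<k. F (x i))\<^sup>2)"
    unfolding sq by (intro Bochner_Integration.integrable_sum *)
  \<comment> \<open>The variance on the diagonal plus a constant, so that the double sum
    splits.\<close>
  have **: "(\<integral>x. F (x i) * F (x j) \<partial>?Q) =
      (if i = j then (\<integral>x. (F x)\<^sup>2 \<partial>M) - (integral\<^sup>L M F)\<^sup>2 else 0) + (integral\<^sup>L M F)\<^sup>2" for i j
    using integral_component_mult(2)[OF F, of i j] integral_component[OF F2, of i]
    by (cases "i = j") (auto simp: power2_eq_square)
  have "(\<integral>x. (\<Sum>i<k. F (x i))\<^sup>2 \<partial>?Q) = (\<Sum>i<k. \<Sum>j<k. \<integral>x. F (x i) * F (x j) \<partial>?Q)"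
    unfolding sq by (simp add: Bochner_Integration.integral_sum Bochner_Integration.integrable_sum *)
  also have "\<dots> = real k * ((\<integral>x. (F x)\<^sup>2 \<partial>M) - (integral\<^sup>L M F)\<^sup>2) + real k * (real k * (integral\<^sup>L M F)\<^sup>2)"
    unfolding ** by (simp add: sum.distrib algebra_simps)
  finally show "(\<integral>x. (\<Sum>i<k. F (x i))\<^sup>2 \<partial>?Q)
      = real k * (\<integral>x. (F x)\<^sup>2 \<partial>M) + (real k ^ 2 - real k) * (integral\<^sup>L M F)\<^sup>2"
    by (simp add: algebra_simps power2_eq_square)
qed

section \<open>The canonical weighted Galton-Watson tree\<close>

locale gw_law =
  fixes p :: "nat pmf" and D :: "real measure" and m :: real
  assumes prob_D: "prob_space D" and sets_D [measurable_cong]: "sets D = sets borel"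
    and mean: "m = measure_pmf.expectation p real"
    and integrable_p: "integrable (measure_pmf p) real"
    and m_gt1: "1 < m"
begin

sublocale D: prob_space D by (rule prob_D)

definition L :: "(nat \<times> real) measure" where
  "L = measure_pmf p \<Otimes>\<^sub>M D"

definition P :: "config measure" where
  "P = PiM UNIV (\<lambda>_. L)"

text \<open>The law of the sequence of subtrees at the children of the root.\<close>

definition Th :: "(nat \<Rightarrow> config) measure" where
  "Th = PiM UNIV (\<lambda>_. P)"

lemma prob_L: "prob_space L"
proof -
  interpret pair_prob_space "measure_pmf p" D ..
  show ?thesis unfolding L_def by (rule prob_space_axioms)
qed

sublocale P: prob_space P
  unfolding P_def by (rule prob_space_PiM) (rule prob_L)

sublocale Th: prob_space Th
  unfolding Th_def by (rule prob_space_PiM) (rule P.prob_space_axioms)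

sublocale pTh: pair_prob_space "measure_pmf p" Th ..

sublocale DpTh: pair_prob_space D "measure_pmf p \<Otimes>\<^sub>M Th" ..

lemma subtree_measurable [measurable]: "subtree i \<in> P \<rightarrow>\<^sub>M P"
  unfolding P_def by (rule measurable_subtree)

lemma measurable_fst_root [measurable]: "(\<lambda>z. fst (z [])) \<in> P \<rightarrow>\<^sub>M count_space UNIV"
  unfolding P_def L_def by (rule measurable_PiM_component_rev) simp_all

lemma measurable_snd_root [measurable]: "(\<lambda>z. snd (z [])) \<in> borel_measurable P"
proof -
  have "snd \<in> borel_measurable L"
    unfolding L_def measurable_cong_sets[OF refl sets_D, symmetric] by (rule measurable_snd)
  then show ?thesis unfolding P_def by (intro measurable_PiM_component_rev) simp_all
qed

lemma measurable_subtrees [measurable]: "(\<lambda>z i. subtree i z) \<in> P \<rightarrow>\<^sub>M Th"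
  unfolding Th_def by (intro measurable_PiM_single') (auto intro: measurable_space[OF subtree_measurable])

lemma measurable_Th_component [measurable]: "(\<lambda>x. x i) \<in> Th \<rightarrow>\<^sub>M P"
  unfolding Th_def by measurable

lemma measurable_root_factor [measurable]:
  "(\<lambda>z. (snd (z []), fst (z []), \<lambda>i. subtree i z)) \<in> P \<rightarrow>\<^sub>M D \<Otimes>\<^sub>M (measure_pmf p \<Otimes>\<^sub>M Th)"
proof -
  have "(\<lambda>z. snd (z [])) \<in> P \<rightarrow>\<^sub>M D"
    unfolding measurable_cong_sets[OF refl sets_D] by (rule measurable_snd_root)
  moreover have "(\<lambda>z. fst (z [])) \<in> P \<rightarrow>\<^sub>M measure_pmf p" by simp
  ultimately show ?thesis by (intro measurable_Pair measurable_subtrees)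
qed

lemma distr_root_factor:
  "distr P (D \<Otimes>\<^sub>M (measure_pmf p \<Otimes>\<^sub>M Th)) (\<lambda>z. (snd (z []), fst (z []), \<lambda>i. subtree i z))
     = D \<Otimes>\<^sub>M (measure_pmf p \<Otimes>\<^sub>M Th)"
proof -
  have 1: "distr P (L \<Otimes>\<^sub>M Th) (\<lambda>z. (z [], \<lambda>i. subtree i z)) = L \<Otimes>\<^sub>M Th"
    using distr_root_subtrees[OF prob_L] by (simp add: P_def Th_def)
  have [measurable]: "(\<lambda>z. z []) \<in> P \<rightarrow>\<^sub>M L"
    unfolding P_def by measurable
  have [measurable]: "(\<lambda>x. (snd (fst x), (fst (fst x), snd x))) \<in> L \<Otimes>\<^sub>M Th \<rightarrow>\<^sub>M D \<Otimes>\<^sub>M (measure_pmf p \<Otimes>\<^sub>M Th)"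
    unfolding L_def by measurable
  have "distr (distr P (L \<Otimes>\<^sub>M Th) (\<lambda>z. (z [], \<lambda>i. subtree i z))) (D \<Otimes>\<^sub>M (measure_pmf p \<Otimes>\<^sub>M Th))
     (\<lambda>x. (snd (fst x), (fst (fst x), snd x))) = D \<Otimes>\<^sub>M (measure_pmf p \<Otimes>\<^sub>M Th)"
    unfolding 1 unfolding L_def
    by (rule distr_pair_swap_factor) (auto intro: measure_pmf.prob_space_axioms prob_D Th.prob_space_axioms)
  then show ?thesis
    by (subst (asm) distr_distr) (auto simp: comp_def)
qed

lemma integral_root_factor:
  fixes f :: "real \<times> nat \<times> (nat \<Rightarrow> config) \<Rightarrow> real"
  assumes f: "f \<in> borel_measurable (D \<Otimes>\<^sub>M (measure_pmf p \<Otimes>\<^sub>M Th))"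
  shows "integrable P (\<lambda>z. f (snd (z []), fst (z []), \<lambda>i. subtree i z))
      \<longleftrightarrow> integrable (D \<Otimes>\<^sub>M (measure_pmf p \<Otimes>\<^sub>M Th)) f"
    and "(\<integral>z. f (snd (z []), fst (z []), \<lambda>i. subtree i z) \<partial>P)
      = integral\<^sup>L (D \<Otimes>\<^sub>M (measure_pmf p \<Otimes>\<^sub>M Th)) f"
proof -
  let ?N = "D \<Otimes>\<^sub>M (measure_pmf p \<Otimes>\<^sub>M Th)"
  let ?\<phi> = "\<lambda>z. (snd (z []), fst (z []), \<lambda>i. subtree i z)"
  show "integrable P (\<lambda>z. f (?\<phi> z)) \<longleftrightarrow> integrable ?N f"
    using integrable_distr_eq[OF measurable_root_factor f] unfolding distr_root_factor by simp
  show "(\<integral>z. f (?\<phi> z) \<partial>P) = integral\<^sup>L ?N f"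
    using integral_distr[OF measurable_root_factor f] unfolding distr_root_factor by simp
qed

text \<open>The weight above the root is independent of everything below it. This gives
  integrability of products such as \<open>xi * c^2\<close> without higher moments of either
  factor.\<close>

lemma integral_mult_root:
  fixes h :: "real \<Rightarrow> real" and K :: "nat \<times> (nat \<Rightarrow> config) \<Rightarrow> real"
  assumes h: "integrable D h" and K: "integrable (measure_pmf p \<Otimes>\<^sub>M Th) K"
  shows "integrable P (\<lambda>z. h (snd (z [])) * K (fst (z []), \<lambda>i. subtree i z))" (is ?A)
    and "(\<integral>z. h (snd (z [])) * K (fst (z []), \<lambda>i. subtree i z) \<partial>P)
      = integral\<^sup>L D h * integral\<^sup>L (measure_pmf p \<Otimes>\<^sub>M Th) K" (is ?B)
proof -
  let ?f = "\<lambda>x. h (fst x) * K (snd x)"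
  have [measurable]: "h \<in> borel_measurable D" "K \<in> borel_measurable (measure_pmf p \<Otimes>\<^sub>M Th)"
    using h K by auto
  have i: "integrable (D \<Otimes>\<^sub>M (measure_pmf p \<Otimes>\<^sub>M Th)) ?f"
    by (rule DpTh.Fubini_integrable) (use h K in \<open>auto simp: abs_mult\<close>)
  show ?A using integral_root_factor(1)[of ?f] i by simp
  have "integral\<^sup>L (D \<Otimes>\<^sub>M (measure_pmf p \<Otimes>\<^sub>M Th)) ?f = (\<integral>x. \<integral>y. h x * K y \<partial>(measure_pmf p \<Otimes>\<^sub>M Th) \<partial>D)"
    using DpTh.integral_fst'[OF i] by simp
  then show ?B using integral_root_factor(2)[of ?f] by simp
qed

lemma integral_root:
  fixes h :: "real \<Rightarrow> real"
  assumes h: "integrable D h"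
  shows "integrable P (\<lambda>z. h (snd (z [])))" "(\<integral>z. h (snd (z [])) \<partial>P) = integral\<^sup>L D h"
  using integral_mult_root[OF h, of "\<lambda>_. 1"] by (simp_all add: pTh.prob_space)

lemma integral_tree:
  fixes K :: "nat \<times> (nat \<Rightarrow> config) \<Rightarrow> real"
  assumes K [measurable]: "K \<in> borel_measurable (measure_pmf p \<Otimes>\<^sub>M Th)"
  shows "integrable P (\<lambda>z. K (fst (z []), \<lambda>i. subtree i z)) \<longleftrightarrow> integrable (measure_pmf p \<Otimes>\<^sub>M Th) K"
    and "(\<integral>z. K (fst (z []), \<lambda>i. subtree i z) \<partial>P) = integral\<^sup>L (measure_pmf p \<Otimes>\<^sub>M Th) K"
proof -
  \<comment> \<open>The marginal of the full factorisation that forgets the weight above the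
    root.\<close>
  have *: "distr P (measure_pmf p \<Otimes>\<^sub>M Th) (\<lambda>z. (fst (z []), \<lambda>i. subtree i z)) = measure_pmf p \<Otimes>\<^sub>M Th"
  proof -
    have "distr (D \<Otimes>\<^sub>M (measure_pmf p \<Otimes>\<^sub>M Th)) (measure_pmf p \<Otimes>\<^sub>M Th) snd = measure_pmf p \<Otimes>\<^sub>M Th"
    proof (rule measure_eqI)
      fix A assume "A \<in> sets (distr (D \<Otimes>\<^sub>M (measure_pmf p \<Otimes>\<^sub>M Th)) (measure_pmf p \<Otimes>\<^sub>M Th) snd)"
      then have A: "A \<in> sets (measure_pmf p \<Otimes>\<^sub>M Th)" by simp
      then have "snd -` A \<inter> space (D \<Otimes>\<^sub>M (measure_pmf p \<Otimes>\<^sub>M Th)) = space D \<times> A"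
        using sets.sets_into_space[OF A] by (auto simp: space_pair_measure)
      then show "emeasure (distr (D \<Otimes>\<^sub>M (measure_pmf p \<Otimes>\<^sub>M Th)) (measure_pmf p \<Otimes>\<^sub>M Th) snd) A
          = emeasure (measure_pmf p \<Otimes>\<^sub>M Th) A"
        using A by (simp add: emeasure_distr pTh.emeasure_pair_measure_Times D.emeasure_space_1)
    qed simp
    then show ?thesis
      by (subst (asm) distr_root_factor[symmetric], subst (asm) distr_distr)
         (auto simp: comp_def measurable_root_factor)
  qed
  show "integrable P (\<lambda>z. K (fst (z []), \<lambda>i. subtree i z)) \<longleftrightarrow> integrable (measure_pmf p \<Otimes>\<^sub>M Th) K"
    by (subst *[symmetric]) (simp add: integrable_distr_eq)
  show "(\<integral>z. K (fst (z []), \<lambda>i. subtree i z) \<partial>P) = integral\<^sup>L (measure_pmf p \<Otimes>\<^sub>M Th) K"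
    by (subst *[symmetric]) (simp add: integral_distr)
qed

section \<open>Averaging over the children of the root\<close>

text \<open>The operator \<open>T\<close> of the introduction. It does not look at
  \<open>snd (z [])\<close>, so \<open>avg F\<close> is independent of the weight above the
  root.\<close>

definition avg :: "(config \<Rightarrow> real) \<Rightarrow> config \<Rightarrow> real" where
  "avg F z = (\<Sum>i<fst (z []). F (subtree i z)) / m"

lemma m_pos: "0 < m" using m_gt1 by simp

lemma measurable_random_sum [measurable]:
  fixes F :: "config \<Rightarrow> real"
  assumes [measurable]: "F \<in> borel_measurable P"
  shows "(\<lambda>x. \<Sum>i<fst x. F (snd x i)) \<in> borel_measurable (measure_pmf p \<Otimes>\<^sub>M Th)"
proof (rule measurable_compose_countable[where g = fst])
  have "(\<lambda>x. F (snd x i)) \<in> borel_measurable (measure_pmf p \<Otimes>\<^sub>M Th)" for i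
    by (rule measurable_compose[OF measurable_compose[OF measurable_snd measurable_Th_component] assms])
  then show "(\<lambda>x. \<Sum>i<k. F (snd x i)) \<in> borel_measurable (measure_pmf p \<Otimes>\<^sub>M Th)" for k
    by (intro borel_measurable_sum)
qed simp

lemma measurable_avg [measurable]:
  assumes [measurable]: "F \<in> borel_measurable P"
  shows "avg F \<in> borel_measurable P"
proof -
  have "(\<lambda>z. \<Sum>i<k. F (subtree i z)) \<in> borel_measurable P" for k
    by (intro borel_measurable_sum measurable_compose[OF subtree_measurable assms])
  then have "(\<lambda>z. \<Sum>i<fst (z []). F (subtree i z)) \<in> borel_measurable P"
    by (rule measurable_compose_countable) (rule measurable_fst_root)
  then show ?thesis unfolding avg_def[abs_def] by simp
qed

text \<open>Wald's identity: given \<open>k\<close> children the sum has mean \<open>k\<close> times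
  that of \<open>F\<close>, and dividing by \<open>m\<close> restores the mean of \<open>F\<close>.
  The third claim is the form on the product space that \<open>integral_mult_root\<close>
  takes.\<close>

lemma integral_avg:
  assumes F: "integrable P F"
  shows "integrable P (avg F)" and "integral\<^sup>L P (avg F) = integral\<^sup>L P F"
    and "integrable (measure_pmf p \<Otimes>\<^sub>M Th) (\<lambda>x. (\<Sum>i<fst x. F (snd x i)) / m)"
proof -
  note [measurable] = borel_measurable_integrable[OF F]
  let ?K = "\<lambda>x. \<Sum>i<fst x. F (snd x i)"
  have comp: "integrable Th (\<lambda>x. F (x i))" "(\<integral>x. F (x i) \<partial>Th) = integral\<^sup>L P F" for i
    unfolding Th_def by (rule P.integrable_component P.integral_component, fact)+
  have nF: "integrable P (\<lambda>z. norm (F z))" using F by simp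
  have comp': "integrable Th (\<lambda>x. norm (F (x i)))" "(\<integral>x. norm (F (x i)) \<partial>Th) = (\<integral>z. norm (F z) \<partial>P)" for i
    unfolding Th_def using P.integrable_component[OF nF] P.integral_component[OF nF] by auto
  have iK: "integrable (measure_pmf p \<Otimes>\<^sub>M Th) ?K"
  proof (rule pTh.Fubini_integrable)
    show "AE k in measure_pmf p. integrable Th (\<lambda>x. ?K (k, x))"
      using comp by auto
    show "integrable (measure_pmf p) (\<lambda>k. \<integral>x. norm (?K (k, x)) \<partial>Th)"
    proof (rule Bochner_Integration.integrable_bound)
      show "integrable (measure_pmf p) (\<lambda>k. real k * (\<integral>z. norm (F z) \<partial>P))"
        using integrable_p by simp
      have "(\<integral>x. norm (?K (k, x)) \<partial>Th) \<le> real k * (\<integral>z. norm (F z) \<partial>P)" for k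
      proof -
        have "(\<integral>x. norm (?K (k, x)) \<partial>Th) \<le> (\<integral>x. (\<Sum>i<k. norm (F (x i))) \<partial>Th)"
          using comp comp' by (intro integral_mono) (auto intro!: sum_norm_le)
        also have "\<dots> = real k * (\<integral>z. norm (F z) \<partial>P)"
          using comp' by (subst Bochner_Integration.integral_sum) auto
        finally show ?thesis .
      qed
      then show "AE k in measure_pmf p. norm (\<integral>x. norm (?K (k, x)) \<partial>Th)
          \<le> norm (real k * (\<integral>z. norm (F z) \<partial>P))"
        by (auto intro!: AE_I2 order_trans[OF _ abs_ge_self])
    qed auto
  qed auto
  have "integral\<^sup>L (measure_pmf p \<Otimes>\<^sub>M Th) ?K = (\<integral>k. real k * integral\<^sup>L P F \<partial>measure_pmf p)"
    using pTh.integral_fst'[OF iK] comp by simp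
  also have "\<dots> = m * integral\<^sup>L P F" by (simp add: mean)
  finally have v: "integral\<^sup>L (measure_pmf p \<Otimes>\<^sub>M Th) ?K = m * integral\<^sup>L P F" .
  show "integrable (measure_pmf p \<Otimes>\<^sub>M Th) (\<lambda>x. ?K x / m)" using iK by simp
  show "integrable P (avg F)" "integral\<^sup>L P (avg F) = integral\<^sup>L P F"
    unfolding avg_def[abs_def] using integral_tree[of ?K] iK v m_pos by simp_all
qed

end

locale gw_law_L2 = gw_law +
  assumes integrable_p2: "integrable (measure_pmf p) (\<lambda>k. real k ^ 2)"
begin

text \<open>The normalised second factorial moment of the offspring law.\<close>

definition q :: real where
  "q = (\<integral>k. real k ^ 2 - real k \<partial>measure_pmf p) / m\<^sup>2"

lemma q_nonneg: "0 \<le> q"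
  unfolding q_def by (intro divide_nonneg_nonneg integral_nonneg_AE)
    (auto intro!: AE_I2 simp: power2_eq_square le_square simp flip: of_nat_mult)

text \<open>Given \<open>k\<close> children there are \<open>k\<close> diagonal and
  \<open>k^2 - k\<close> off-diagonal terms, the latter with independent factors. Averaging over
  \<open>k\<close> turns the counts into \<open>m\<close> and \<open>q * m^2\<close>.\<close>

lemma integral_avg_square:
  assumes F: "integrable P F" and F2: "integrable P (\<lambda>z. (F z)\<^sup>2)"
  shows "integrable P (\<lambda>z. (avg F z)\<^sup>2)"
    and "(\<integral>z. (avg F z)\<^sup>2 \<partial>P) = (\<integral>z. (F z)\<^sup>2 \<partial>P) / m + q * (integral\<^sup>L P F)\<^sup>2"
    and "integrable (measure_pmf p \<Otimes>\<^sub>M Th) (\<lambda>x. ((\<Sum>i<fst x. F (snd x i)) / m)\<^sup>2)"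
proof -
  note [measurable] = borel_measurable_integrable[OF F]
  let ?K = "\<lambda>x. (\<Sum>i<fst x. F (snd x i))\<^sup>2"
  note sq = P.integral_sum_components_square[OF F F2, folded Th_def]
  have ik: "integrable (measure_pmf p) (\<lambda>k. real k * (\<integral>z. (F z)\<^sup>2 \<partial>P) + (real k ^ 2 - real k) * (integral\<^sup>L P F)\<^sup>2)"
    using integrable_p integrable_p2 by simp
  have iK: "integrable (measure_pmf p \<Otimes>\<^sub>M Th) ?K"
    by (rule pTh.Fubini_integrable) (use sq ik in auto)
  have "integral\<^sup>L (measure_pmf p \<Otimes>\<^sub>M Th) ?K =
      (\<integral>k. real k * (\<integral>z. (F z)\<^sup>2 \<partial>P) + (real k ^ 2 - real k) * (integral\<^sup>L P F)\<^sup>2 \<partial>measure_pmf p)"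
    using pTh.integral_fst'[OF iK] sq by simp
  also have "\<dots> = m * (\<integral>z. (F z)\<^sup>2 \<partial>P) + (\<integral>k. real k ^ 2 - real k \<partial>measure_pmf p) * (integral\<^sup>L P F)\<^sup>2"
    using integrable_p integrable_p2 by (subst Bochner_Integration.integral_add) (auto simp: mean)
  finally have v: "integral\<^sup>L (measure_pmf p \<Otimes>\<^sub>M Th) ?K =
      m * (\<integral>z. (F z)\<^sup>2 \<partial>P) + (\<integral>k. real k ^ 2 - real k \<partial>measure_pmf p) * (integral\<^sup>L P F)\<^sup>2" .
  show "integrable (measure_pmf p \<Otimes>\<^sub>M Th) (\<lambda>x. ((\<Sum>i<fst x. F (snd x i)) / m)\<^sup>2)"
    using iK by (simp add: power_divide)
  show "integrable P (\<lambda>z. (avg F z)\<^sup>2)"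
    and "(\<integral>z. (avg F z)\<^sup>2 \<partial>P) = (\<integral>z. (F z)\<^sup>2 \<partial>P) / m + q * (integral\<^sup>L P F)\<^sup>2"
    unfolding avg_def[abs_def] using integral_tree[of ?K] iK v m_pos
    by (simp_all add: power_divide q_def add_divide_distrib) (simp add: power2_eq_square)
qed

end

text \<open>By monotone convergence the sum of the absolute values has finite integral, hence is
  finite almost everywhere.\<close>

lemma AE_summable_of_summable_integrals:
  fixes F :: "nat \<Rightarrow> 'a \<Rightarrow> real"
  assumes F: "\<And>n. integrable M (F n)" and u: "\<And>n. (\<integral>x. \<bar>F n x\<bar> \<partial>M) \<le> u n" "summable u"
  shows "AE x in M. summable (\<lambda>n. \<bar>F n x\<bar>)"
proof -
  have [measurable]: "F n \<in> borel_measurable M" for n using F by auto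
  have u0: "0 \<le> u n" for n
    using u(1)[of n] by (rule order_trans[rotated]) simp
  have "(\<integral>\<^sup>+x. (\<Sum>n. ennreal \<bar>F n x\<bar>) \<partial>M) = (\<Sum>n. \<integral>\<^sup>+x. ennreal \<bar>F n x\<bar> \<partial>M)"
    by (rule nn_integral_suminf) auto
  also have "\<dots> \<le> (\<Sum>n. ennreal (u n))"
    using F u(1) by (intro suminf_le allI) (auto simp: nn_integral_eq_integral ennreal_leI)
  also have "\<dots> < \<infinity>"
    using u(2) u0 by (simp add: suminf_ennreal2 less_top[symmetric])
  finally have "AE x in M. (\<Sum>n. ennreal \<bar>F n x\<bar>) \<noteq> \<infinity>"
    by (intro nn_integral_PInf_AE) auto
  then show ?thesis
    by eventually_elim (auto intro: summable_suminf_not_top)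
qed

text \<open>Comparison with the geometric series of ratio \<open>sqrt x\<close>, using
  \<open>n <= 2 * (n div 2) + 1\<close>.\<close>

lemma summable_power_half:
  fixes x :: real
  assumes "0 < x" "x < 1"
  shows "summable (\<lambda>n. x ^ (n div 2))"
proof (rule summable_comparison_test')
  show "summable (\<lambda>n. sqrt x ^ n / sqrt x)"
    using assms by (intro summable_divide summable_geometric) auto
  fix n :: nat
  have "x ^ (n div 2) * sqrt x = sqrt x ^ (2 * (n div 2) + 1)"
    using assms by (simp add: power_mult)
  also have "\<dots> \<le> sqrt x ^ n"
    using assms by (intro power_decreasing) auto
  finally show "norm (x ^ (n div 2)) \<le> sqrt x ^ n / sqrt x"
    using assms by (simp add: field_simps)
qed

lemma convergent_of_summable_increments:
  fixes f :: "nat \<Rightarrow> real"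
  assumes "summable (\<lambda>n. \<bar>f n - f (Suc n)\<bar>)"
  shows "convergent f"
proof -
  have "summable (\<lambda>n. f n - f (Suc n))"
    using assms by (rule summable_rabs_cancel)
  then have "(\<lambda>n. f 0 - (\<Sum>i<n. f i - f (Suc i))) \<longlonglongrightarrow> f 0 - (\<Sum>n. f n - f (Suc n))"
    by (intro tendsto_intros summable_LIMSEQ)
  moreover have "f 0 - (\<Sum>i<n. f i - f (Suc i)) = f n" for n
    by (induction n) auto
  ultimately show ?thesis by (auto simp: convergent_def)
qed

section \<open>Contraction of iterated averages, and the normalised population size\<close>

context gw_law_L2
begin

abbreviation iter :: "nat \<Rightarrow> (config \<Rightarrow> real) \<Rightarrow> config \<Rightarrow> real" where
  "iter k F \<equiv> (avg ^^ k) F"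

lemma avg_mono:
  assumes "\<And>z. pos_config z \<Longrightarrow> F z \<le> G z" "pos_config z"
  shows "avg F z \<le> avg G z"
  unfolding avg_def using m_pos assms by (intro divide_right_mono sum_mono) auto

lemma avg_diff: "avg (\<lambda>z. s * F z - t * G z) z = s * avg F z - t * avg G z"
  by (simp add: avg_def sum_subtractf sum_distrib_left diff_divide_distrib)

lemma iter_diff: "iter k (\<lambda>z. F z - t * G z) z = iter k F z - t * iter k G z"
proof (induction k arbitrary: z)
  case (Suc k)
  have "iter k (\<lambda>z. F z - t * G z) = (\<lambda>z. 1 * iter k F z - t * iter k G z)"
    using Suc by auto
  then have "iter (Suc k) (\<lambda>z. F z - t * G z) z = avg (\<lambda>z. 1 * iter k F z - t * iter k G z) z"
    by simp
  then show ?case by (subst (asm) avg_diff) simp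
qed simp

lemma integral_iter:
  assumes "integrable P F"
  shows "integrable P (iter k F)" "integral\<^sup>L P (iter k F) = integral\<^sup>L P F"
  by (induction k) (use assms integral_avg in auto)

text \<open>The mean stays 0 under \<open>avg\<close>, so the \<open>q\<close> term drops out and
  each application divides the second moment by \<open>m\<close>.\<close>

lemma integral_iter_square:
  assumes "integrable P F" "integrable P (\<lambda>z. (F z)\<^sup>2)" "integral\<^sup>L P F = 0"
  shows "integrable P (\<lambda>z. (iter k F z)\<^sup>2)"
    and "(\<integral>z. (iter k F z)\<^sup>2 \<partial>P) = (\<integral>z. (F z)\<^sup>2 \<partial>P) / m ^ k"
proof -
  have "integrable P (\<lambda>z. (iter k F z)\<^sup>2) \<and> (\<integral>z. (iter k F z)\<^sup>2 \<partial>P) = (\<integral>z. (F z)\<^sup>2 \<partial>P) / m ^ k"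
  proof (induction k)
    case (Suc k)
    then show ?case
      using integral_avg_square(1,2)[of "iter k F"] integral_iter[OF assms(1), of k] assms(3)
      by (simp add: mult.commute)
  qed (use assms in simp)
  then show "integrable P (\<lambda>z. (iter k F z)\<^sup>2)"
    and "(\<integral>z. (iter k F z)\<^sup>2 \<partial>P) = (\<integral>z. (F z)\<^sup>2 \<partial>P) / m ^ k" by auto
qed

text \<open>The bound of the first absolute moment by the second one is AM-GM in the form
  \<open>2 |x| \<le> x^2 / s + s\<close> with \<open>s = (1 / sqrt m) ^ k\<close>.\<close>

lemma integral_abs_iter_le:
  assumes "integrable P F" "integrable P (\<lambda>z. (F z)\<^sup>2)" "integral\<^sup>L P F = 0"
    and V: "(\<integral>z. (F z)\<^sup>2 \<partial>P) \<le> V"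
  shows "(\<integral>z. \<bar>iter k F z\<bar> \<partial>P) \<le> (V + 1) / 2 * (1 / sqrt m) ^ k"
proof -
  define s where "s = (1 / sqrt m) ^ k"
  have s: "s > 0" "s\<^sup>2 = 1 / m ^ k"
    using m_pos by (auto simp: s_def power_mult[symmetric] mult.commute[of k 2])
      (simp add: power_mult power_divide)
  have am: "\<bar>x\<bar> \<le> (x\<^sup>2 / s + s) / 2" for x
  proof -
    have "0 \<le> (\<bar>x\<bar> - s)\<^sup>2" by simp
    then have "2 * \<bar>x\<bar> * s \<le> x\<^sup>2 + s * s" by (simp add: power2_eq_square algebra_simps)
    then show ?thesis using s(1) by (simp add: field_simps)
  qed
  note sq = integral_iter_square[OF assms(1-3), of k]
  have "(\<integral>z. \<bar>iter k F z\<bar> \<partial>P) \<le> (\<integral>z. ((iter k F z)\<^sup>2 / s + s) / 2 \<partial>P)"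
    using integral_iter[OF assms(1)] sq am by (intro integral_mono) auto
  also have "\<dots> = ((\<integral>z. (F z)\<^sup>2 \<partial>P) / m ^ k / s + s) / 2"
    using sq by (simp add: P.prob_space)
  also have "(\<integral>z. (F z)\<^sup>2 \<partial>P) / m ^ k / s = (\<integral>z. (F z)\<^sup>2 \<partial>P) * s"
  proof -
    have "(\<integral>z. (F z)\<^sup>2 \<partial>P) / m ^ k = (\<integral>z. (F z)\<^sup>2 \<partial>P) * s\<^sup>2" by (simp add: s(2))
    then show ?thesis using s(1) by (simp add: power2_eq_square)
  qed
  also have "((\<integral>z. (F z)\<^sup>2 \<partial>P) * s + s) / 2 \<le> (V * s + s) / 2"
    using V s by (intro divide_right_mono add_right_mono mult_right_mono) auto
  also have "\<dots> = (V + 1) / 2 * s" by (simp add: algebra_simps)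
  finally show ?thesis unfolding s_def .
qed

text \<open>Written as an iterate so that the contraction applies; \<open>W_eq_card\<close>
  identifies it with the normalised size of level \<open>k\<close>.\<close>

definition W :: "nat \<Rightarrow> config \<Rightarrow> real" where
  "W k = iter k (\<lambda>_. 1)"

lemma W_0: "W 0 z = 1"
  by (simp add: W_def)

lemma W_Suc: "W (Suc k) = avg (W k)"
  by (simp add: W_def)

lemma W_eq_card: "W k z = real (card (gw_level (\<lambda>u. fst (z u)) k)) / m ^ k"
proof (induction k arbitrary: z)
  case (Suc k)
  then show ?case
    by (simp add: W_Suc avg_def card_gw_level_Suc sum_divide_distrib mult.commute)
qed (simp add: W_0)

lemma integral_W: "integrable P (W k)" "integral\<^sup>L P (W k) = 1"
  using integral_iter[of "\<lambda>_. 1" k] by (simp_all add: W_def P.prob_space)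

lemma integral_W_square:
  "integrable P (\<lambda>z. (W k z)\<^sup>2)" "(\<integral>z. (W k z)\<^sup>2 \<partial>P) \<le> 1 + q * m / (m - 1)"
proof -
  let ?K = "1 + q * m / (m - 1)"
  have "integrable P (\<lambda>z. (W k z)\<^sup>2) \<and> (\<integral>z. (W k z)\<^sup>2 \<partial>P) \<le> ?K"
  proof (induction k)
    case 0
    then show ?case using q_nonneg m_gt1 by (simp add: W_0 P.prob_space)
  next
    case (Suc k)
    have "(\<integral>z. (W k z)\<^sup>2 \<partial>P) / m + q \<le> ?K / m + q"
      using Suc m_gt1 by (intro add_right_mono divide_right_mono) auto
    \<comment> \<open>The part \<open>q * m / (m - 1)\<close> of the bound is the fixed point of
      \<open>x / m + q\<close>; the initial value 1 only shrinks.\<close>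
    also have "?K / m + q = 1 / m + q * m / (m - 1)"
      using m_gt1 by (simp add: field_simps)
    also have "\<dots> \<le> ?K" using m_gt1 by simp
    finally show ?case
      using integral_avg_square(1,2)[OF integral_W(1), of k] Suc by (simp add: W_Suc integral_W)
  qed
  then show "integrable P (\<lambda>z. (W k z)\<^sup>2)" "(\<integral>z. (W k z)\<^sup>2 \<partial>P) \<le> ?K" by auto
qed

text \<open>The increment at time \<open>k\<close> is the \<open>k\<close>-th iterate of the centred
  first increment, so its mean absolute value decays geometrically.\<close>

lemma AE_convergent_W: "AE z in P. convergent (\<lambda>k. W k z)"
proof -
  \<comment> \<open>The factor 1 gives \<open>F\<close> the shape treated by
    \<open>iter_diff\<close>.\<close>
  define F where "F z = 1 - 1 * W 1 z" for z
  have F: "integrable P F" "integral\<^sup>L P F = 0"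
    unfolding F_def[abs_def] using integral_W[of 1] by (simp_all add: P.prob_space)
  have F2: "integrable P (\<lambda>z. (F z)\<^sup>2)"
    unfolding F_def using integral_W[of 1] integral_W_square[of 1]
    by (simp add: power2_diff)
  have eq: "W k z - W (Suc k) z = iter k F z" for k z
    unfolding F_def iter_diff by (simp add: W_def funpow_swap1)
  have "AE z in P. summable (\<lambda>k. \<bar>iter k F z\<bar>)"
  proof (rule AE_summable_of_summable_integrals)
    show "integrable P (iter k F)" for k by (rule integral_iter[OF F(1)])
    show "(\<integral>z. \<bar>iter k F z\<bar> \<partial>P) \<le> ((\<integral>z. (F z)\<^sup>2 \<partial>P) + 1) / 2 * (1 / sqrt m) ^ k" for k
      by (rule integral_abs_iter_le[OF F(1) F2 F(2)]) simp
    show "summable (\<lambda>k. ((\<integral>z. (F z)\<^sup>2 \<partial>P) + 1) / 2 * (1 / sqrt m) ^ k)"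
      using m_gt1 by (intro summable_mult summable_geometric) auto
  qed
  then show ?thesis
    by eventually_elim (auto intro: convergent_of_summable_increments simp: eq)
qed

end

section \<open>Rescaled conductances\<close>

locale gw_network = gw_law_L2 +
  fixes lam :: real
  assumes m_less_lam: "m < lam"
    and xi_pos: "AE x in D. 0 < x"
    and integrable_xi: "integrable D (\<lambda>x. x)"
    and integrable_inverse_xi: "integrable D (\<lambda>x. 1 / x)"
begin

definition rho :: real where "rho = m / lam"

lemma rho: "0 < rho" "rho < 1"
  using m_pos m_less_lam by (auto simp: rho_def)

lemma lam_pos: "0 < lam" using m_pos m_less_lam by simp

text \<open>The exponents of \<open>rho\<close> in \<open>g\<close> and \<open>c\<close> are matched
  so that, by \<open>lam * rho = m\<close>, the parallel law becomes exactly
  \<open>c n = avg (g n)\<close>.\<close>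

definition g :: "nat \<Rightarrow> config \<Rightarrow> real" where
  "g n z = branch_cond lam n z / rho ^ n"

definition c :: "nat \<Rightarrow> config \<Rightarrow> real" where
  "c n z = root_cond lam n z / rho ^ Suc n"

lemma c_eq_avg: "c n = avg (g n)"
proof
  fix z
  have "lam * rho = m" using lam_pos by (simp add: rho_def)
  then show "c n z = avg (g n) z"
    by (simp add: c_def root_cond_def avg_def g_def sum_divide_distrib[symmetric] mult_ac flip: mult.assoc)
qed

lemma g_0: "g 0 z = 1 / snd (z [])"
  by (simp add: g_def)

lemma g_Suc: "g (Suc n) z = c n z / (1 + snd (z []) * rho ^ Suc n * c n z)"
proof -
  have *: "root_cond lam n z = rho ^ Suc n * c n z" using rho by (simp add: c_def)
  show ?thesis
    using rho by (simp add: g_def branch_cond_Suc * mult_ac del: branch_cond.simps power_Suc)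
qed

lemma g_nonneg: "pos_config z \<Longrightarrow> 0 \<le> g n z"
  using branch_cond_nonneg[OF lam_pos, of z n] rho by (simp add: g_def)

lemma c_nonneg: "pos_config z \<Longrightarrow> 0 \<le> c n z"
  using root_cond_nonneg[OF lam_pos, of z n] rho by (simp add: c_def)

text \<open>With \<open>y = snd (z []) * rho ^ Suc n\<close>, the value
  \<open>c / (1 + y * c)\<close> lies below both \<open>c\<close> and \<open>1 / y\<close>. The
  third bound multiplies these two, making the square linear in \<open>c\<close>.\<close>

lemma g_Suc_bounds:
  assumes "pos_config z"
  shows "g (Suc n) z \<le> c n z"
    and "c n z - g (Suc n) z \<le> rho ^ Suc n * (snd (z []) * (c n z)\<^sup>2)"
    and "(g (Suc n) z)\<^sup>2 \<le> (1 / snd (z []) * c n z) / rho ^ Suc n"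
proof -
  define y where "y = snd (z []) * rho ^ Suc n"
  have y: "0 < y" using pos_config_root[OF assms] rho by (simp add: y_def)
  have c: "0 \<le> c n z" by (rule c_nonneg[OF assms])
  have yc: "0 \<le> y * c n z" using y c by simp
  have gS: "g (Suc n) z = c n z / (1 + y * c n z)" by (simp add: g_Suc y_def)
  show 1: "g (Suc n) z \<le> c n z"
    unfolding gS using c yc mult_nonneg_nonneg[OF yc c] by (simp add: divide_le_eq algebra_simps)
  have "c n z - g (Suc n) z = y * (c n z)\<^sup>2 / (1 + y * c n z)"
    unfolding gS using yc by (simp add: field_simps power2_eq_square)
  also have "\<dots> \<le> y * (c n z)\<^sup>2"
  proof -
    have "0 \<le> y * (c n z)\<^sup>2 * (y * c n z)" using yc y by simp
    then show ?thesis using yc by (simp add: divide_le_eq distrib_left)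
  qed
  finally show "c n z - g (Suc n) z \<le> rho ^ Suc n * (snd (z []) * (c n z)\<^sup>2)"
    by (simp add: y_def algebra_simps)
  have 2: "g (Suc n) z \<le> 1 / y"
    unfolding gS using y yc by (simp add: field_simps)
  have "(g (Suc n) z)\<^sup>2 \<le> 1 / y * c n z"
    unfolding power2_eq_square using 1 2 g_nonneg[OF assms] y by (intro mult_mono) auto
  then show "(g (Suc n) z)\<^sup>2 \<le> (1 / snd (z []) * c n z) / rho ^ Suc n"
    by (simp add: y_def)
qed

section \<open>Measurability and the first two moments of the rescaled conductances\<close>

lemma measurable_g [measurable]: "g n \<in> borel_measurable P"
proof (induction n)
  case 0
  show ?case unfolding g_0[abs_def] by measurable
next
  case (Suc n)
  note [measurable] = Suc
  show ?case unfolding g_Suc[abs_def] c_eq_avg by measurable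
qed

lemma measurable_c [measurable]: "c n \<in> borel_measurable P"
  unfolding c_eq_avg by measurable

lemma AE_pos_config: "AE z in P. pos_config z"
proof -
  interpret pD: pair_prob_space "measure_pmf p" D ..
  have "AE x in L. 0 < snd x"
    unfolding L_def
  proof (rule pD.AE_pair_measure)
    have [measurable]: "snd \<in> borel_measurable (measure_pmf p \<Otimes>\<^sub>M D)"
      unfolding measurable_cong_sets[OF refl sets_D, symmetric] by (rule measurable_snd)
    show "{x \<in> space (measure_pmf p \<Otimes>\<^sub>M D). 0 < snd x} \<in> sets (measure_pmf p \<Otimes>\<^sub>M D)"
      by measurable
  qed (use xi_pos in simp)
  then have "AE z in P. 0 < snd (z u)" for u
    unfolding P_def by (intro AE_PiM_component) (auto intro: prob_L)
  then show ?thesis unfolding pos_config_def by (subst AE_all_countable) simp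
qed

text \<open>Integrability starts from \<open>g 0\<close>, the inverse weight, and is propagated by
  \<open>avg\<close> and by domination of \<open>g (Suc n)\<close> by \<open>c n\<close>.\<close>

lemma integrable_g: "integrable P (g n)"
proof (induction n)
  case 0
  show ?case unfolding g_0[abs_def] by (rule integral_root[OF integrable_inverse_xi])
next
  case (Suc n)
  have "integrable P (c n)" unfolding c_eq_avg by (rule integral_avg[OF Suc])
  then show ?case
  proof (rule Bochner_Integration.integrable_bound)
    show "AE z in P. norm (g (Suc n) z) \<le> norm (c n z)"
      using AE_pos_config by eventually_elim (use g_Suc_bounds(1) g_nonneg c_nonneg in auto)
  qed simp
qed

definition a :: "nat \<Rightarrow> real" where "a n = integral\<^sup>L P (g n)"

lemma integral_c: "integrable P (c n)" "integral\<^sup>L P (c n) = a n"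
  unfolding c_eq_avg a_def using integral_avg[OF integrable_g] by auto

lemma a_nonneg: "0 \<le> a n"
  unfolding a_def using AE_pos_config
  by (intro integral_nonneg_AE) (auto elim: eventually_mono intro: g_nonneg)

lemma a_Suc_le: "a (Suc n) \<le> a n"
proof -
  have "integral\<^sup>L P (g (Suc n)) \<le> integral\<^sup>L P (c n)"
    using AE_pos_config by (intro integral_mono_AE integrable_g integral_c)
      (auto elim!: eventually_mono intro: g_Suc_bounds(1))
  then show ?thesis by (simp add: a_def[symmetric] integral_c)
qed

lemma decseq_a: "decseq a"
  by (rule decseq_SucI) (rule a_Suc_le)

lemma integral_mult_root_c:
  assumes "integrable D h"
  shows "integrable P (\<lambda>z. h (snd (z [])) * c n z)"
  using integral_mult_root(1)[OF assms integral_avg(3)[OF integrable_g, of n]]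
  by (simp add: c_eq_avg avg_def)

text \<open>The second moment of \<open>1 / \<xi>\<close> may be infinite, so \<open>g 0\<close> and \<open>c 0\<close> need not be square
  integrable; from \<open>g 1\<close> on, the bound by the product of two independent variables applies.\<close>

lemma integrable_g_square: "integrable P (\<lambda>z. (g (Suc n) z)\<^sup>2)"
proof (rule Bochner_Integration.integrable_bound)
  show "integrable P (\<lambda>z. (1 / snd (z []) * c n z) / rho ^ Suc n)"
    using integral_mult_root_c[OF integrable_inverse_xi, of n] by (intro Bochner_Integration.integrable_divide) simp
  show "AE z in P. norm ((g (Suc n) z)\<^sup>2) \<le> norm ((1 / snd (z []) * c n z) / rho ^ Suc n)"
    using AE_pos_config
    by eventually_elim (metis g_Suc_bounds(3) abs_ge_self order_trans real_norm_def abs_power2)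
qed simp

lemma integral_c_square:
  "integrable P (\<lambda>z. (c (Suc n) z)\<^sup>2)"
  "(\<integral>z. (c (Suc n) z)\<^sup>2 \<partial>P) = (\<integral>z. (g (Suc n) z)\<^sup>2 \<partial>P) / m + q * (a (Suc n))\<^sup>2"
  unfolding c_eq_avg a_def using integral_avg_square[OF integrable_g integrable_g_square] by auto

lemma integral_xi_c_square:
  "integrable P (\<lambda>z. snd (z []) * (c (Suc n) z)\<^sup>2)"
  "(\<integral>z. snd (z []) * (c (Suc n) z)\<^sup>2 \<partial>P) = integral\<^sup>L D (\<lambda>x. x) * (\<integral>z. (c (Suc n) z)\<^sup>2 \<partial>P)"
proof -
  note K = integral_avg_square(3)[OF integrable_g integrable_g_square, of n]
  show "integrable P (\<lambda>z. snd (z []) * (c (Suc n) z)\<^sup>2)"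
    using integral_mult_root(1)[OF integrable_xi K] by (simp add: c_eq_avg avg_def)
  show "(\<integral>z. snd (z []) * (c (Suc n) z)\<^sup>2 \<partial>P) = integral\<^sup>L D (\<lambda>x. x) * (\<integral>z. (c (Suc n) z)\<^sup>2 \<partial>P)"
    using integral_mult_root(2)[OF integrable_xi K]
      integral_tree(2)[OF borel_measurable_integrable[OF K]] by (simp add: c_eq_avg avg_def)
qed

text \<open>Since \<open>g (Suc n) <= c n\<close>, the second moments satisfy
  \<open>b (Suc n) <= b n / m + K\<close>, a recursion with contraction factor
  \<open>1 / m\<close>.\<close>

lemma c_square_bounded: "\<exists>B. \<forall>n. (\<integral>z. (c (Suc n) z)\<^sup>2 \<partial>P) \<le> B"
proof -
  define b where "b n = (\<integral>z. (g (Suc n) z)\<^sup>2 \<partial>P)" for n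
  define K where "K = q * (a 0)\<^sup>2"
  \<comment> \<open>The larger of the initial value and the fixed point of
    \<open>x / m + K\<close>.\<close>
  define B where "B = max (b 0) (K * m / (m - 1))"
  have K: "q * (a n)\<^sup>2 \<le> K" for n
    unfolding K_def using decseqD[OF decseq_a, of 0 n] a_nonneg q_nonneg
    by (intro mult_left_mono power_mono) auto
  have "K * m / (m - 1) \<le> B" by (simp add: B_def)
  then have B: "B / m + K \<le> B" using m_gt1 by (simp add: field_simps)
  have c: "(\<integral>z. (c (Suc n) z)\<^sup>2 \<partial>P) \<le> B" if "b n \<le> B" for n
  proof -
    have "(\<integral>z. (c (Suc n) z)\<^sup>2 \<partial>P) \<le> B / m + K"
      unfolding integral_c_square b_def[symmetric]
      using that m_pos K by (intro add_mono divide_right_mono) auto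
    then show ?thesis using B by simp
  qed
  have "b n \<le> B" for n
  proof (induction n)
    case (Suc n)
    have "b (Suc n) \<le> (\<integral>z. (c (Suc n) z)\<^sup>2 \<partial>P)"
      unfolding b_def using AE_pos_config
      by (intro integral_mono_AE integrable_g_square integral_c_square)
        (auto elim!: eventually_mono intro!: power_mono g_Suc_bounds(1) g_nonneg)
    then show ?case using c[OF Suc] by simp
  qed (simp add: B_def)
  then show ?thesis using c by auto
qed

lemma a_increment_le:
  "a (Suc n) - a (Suc (Suc n)) \<le> rho ^ Suc (Suc n) * (integral\<^sup>L D (\<lambda>x. x) * (\<integral>z. (c (Suc n) z)\<^sup>2 \<partial>P))"
proof -
  have "a (Suc n) - a (Suc (Suc n)) = (\<integral>z. c (Suc n) z - g (Suc (Suc n)) z \<partial>P)"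
    using integral_c integrable_g by (simp add: a_def)
  also have "\<dots> \<le> (\<integral>z. rho ^ Suc (Suc n) * (snd (z []) * (c (Suc n) z)\<^sup>2) \<partial>P)"
    using AE_pos_config integral_c integrable_g integral_xi_c_square
    by (intro integral_mono_AE) (auto elim!: eventually_mono intro!: g_Suc_bounds(2) simp del: power_Suc)
  finally show ?thesis using integral_xi_c_square by (simp del: power_Suc)
qed

section \<open>Geometric tail of the means and their positive limit\<close>

lemma xi_mean_nonneg: "0 \<le> integral\<^sup>L D (\<lambda>x. x)"
  using xi_pos by (intro integral_nonneg_AE) (auto elim: eventually_mono)

lemma a_tail_le: "\<exists>K. \<forall>j k. a (Suc j) - a (Suc j + k) \<le> K * rho ^ j"
proof -
  obtain B where B: "\<And>n. (\<integral>z. (c (Suc n) z)\<^sup>2 \<partial>P) \<le> B" using c_square_bounded by auto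
  define E where "E = integral\<^sup>L D (\<lambda>x. x) * B"
  \<comment> \<open>The increments are at most \<open>E * rho ^ (i + 2)\<close>; summing over
    \<open>i >= j\<close> gives \<open>K * rho ^ j\<close>.\<close>
  define K where "K = E * rho\<^sup>2 / (1 - rho)"
  have inc: "a (Suc n) - a (Suc (Suc n)) \<le> rho ^ Suc (Suc n) * E" for n
    using a_increment_le[of n] by (rule order_trans)
      (use rho xi_mean_nonneg B in \<open>auto simp: E_def intro!: mult_left_mono\<close>)
  have "0 \<le> (\<integral>z. (c (Suc 0) z)\<^sup>2 \<partial>P)" by simp
  also have "\<dots> \<le> B" by (rule B)
  finally have "0 \<le> K" using rho xi_mean_nonneg by (simp add: K_def E_def)
  \<comment> \<open>The exact partial geometric sum is kept so that the induction on
    \<open>k\<close> closes.\<close>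
  have *: "a (Suc j) - a (Suc j + k) \<le> K * rho ^ j * (1 - rho ^ k)" for j k
  proof (induction k)
    case (Suc k)
    have "a (Suc j) - a (Suc j + Suc k)
        = (a (Suc j) - a (Suc j + k)) + (a (Suc (j + k)) - a (Suc (Suc (j + k))))" by simp
    also have "\<dots> \<le> K * rho ^ j * (1 - rho ^ k) + rho ^ Suc (Suc (j + k)) * E"
      using Suc inc by (intro add_mono) auto
    also have "rho ^ Suc (Suc (j + k)) * E = K * (1 - rho) * rho ^ (j + k)"
      using rho by (simp add: K_def power2_eq_square)
    also have "K * rho ^ j * (1 - rho ^ k) + K * (1 - rho) * rho ^ (j + k) = K * rho ^ j * (1 - rho ^ Suc k)"
      by (simp add: power_add algebra_simps)
    finally show ?case .
  qed simp
  have "K * rho ^ j * (1 - rho ^ k) \<le> K * rho ^ j" for j k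
    using rho \<open>0 \<le> K\<close> by (simp add: mult_left_le)
  then show ?thesis using * order_trans by blast
qed

text \<open>\<^term>\<open>e\<close> is the rescaled energy of the uniform flow of strength \<open>W\<close>; the lower bound is Thomson's
  principle, linearised so that it can be integrated.\<close>

primrec e :: "nat \<Rightarrow> config \<Rightarrow> real" where
  "e 0 z = snd (z [])"
| "e (Suc n) z = avg (e n) z + rho ^ Suc n * (snd (z []) * (W (Suc n) z)\<^sup>2)"

lemma integral_xi_W_square:
  "integrable P (\<lambda>z. snd (z []) * (W (Suc n) z)\<^sup>2)"
  "(\<integral>z. snd (z []) * (W (Suc n) z)\<^sup>2 \<partial>P) = integral\<^sup>L D (\<lambda>x. x) * (\<integral>z. (W (Suc n) z)\<^sup>2 \<partial>P)"
proof -
  note K = integral_avg_square(3)[OF integral_W(1) integral_W_square(1), of n]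
  show "integrable P (\<lambda>z. snd (z []) * (W (Suc n) z)\<^sup>2)"
    using integral_mult_root(1)[OF integrable_xi K] by (simp add: W_Suc avg_def)
  show "(\<integral>z. snd (z []) * (W (Suc n) z)\<^sup>2 \<partial>P) = integral\<^sup>L D (\<lambda>x. x) * (\<integral>z. (W (Suc n) z)\<^sup>2 \<partial>P)"
    using integral_mult_root(2)[OF integrable_xi K]
      integral_tree(2)[OF borel_measurable_integrable[OF K]] by (simp add: W_Suc avg_def)
qed

text \<open>Where \<open>e n z > 0\<close>, the best \<open>t\<close> would give
  \<open>(W n z)^2 / e n z <= g n z\<close>. Keeping \<open>t\<close> free makes the bound linear in
  \<open>W\<close> and \<open>e\<close>, and lets the induction apply it with a rescaled
  parameter.\<close>

lemma g_ge_flow: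
  assumes "pos_config z"
  shows "2 * t * W n z - t\<^sup>2 * e n z \<le> g n z"
  using assms
proof (induction n arbitrary: z t)
  case 0
  have x: "0 < snd (z [])" by (rule pos_config_root[OF 0])
  have "0 \<le> (1 - t * snd (z []))\<^sup>2" by simp
  then show ?case using x by (simp add: g_0 W_0 field_simps power2_eq_square)
next
  case (Suc n)
  let ?x = "snd (z [])" and ?w = "W (Suc n) z" and ?E = "avg (e n) z"
  define y where "y = ?x * rho ^ Suc n"
  have y: "0 < y" using pos_config_root[OF Suc.prems] rho by (simp add: y_def)
  have c0: "0 \<le> c n z" by (rule c_nonneg[OF Suc.prems])
  have c: "2 * t * ?w - t\<^sup>2 * ?E \<le> c n z" for t
  proof -
    have "2 * t * ?w - t\<^sup>2 * ?E = avg (\<lambda>z. (2 * t) * W n z - t\<^sup>2 * e n z) z"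
      by (simp only: avg_diff W_Suc)
    also have "\<dots> \<le> c n z"
      unfolding c_eq_avg using Suc by (intro avg_mono) auto
    finally show ?thesis .
  qed
  \<comment> \<open>The potential at the root when the upper end of the additional edge has
    potential 1. The term \<open>2 * t * W\<close> is split as \<open>1 - s\<close> for this edge
    and \<open>s\<close> for the tree below.\<close>
  define s where "s = 1 / (1 + y * c n z)"
  have pos: "0 < 1 + y * c n z" using y c0 by (simp add: add_pos_nonneg)
  have s: "0 < s" using pos by (simp add: s_def)
  have g: "g (Suc n) z = (1 - s)\<^sup>2 / y + c n z * s\<^sup>2"
    using series_law_eq[OF y c0, of 1] by (simp add: g_Suc s_def y_def)
  \<comment> \<open>The tree below sees potential \<open>s\<close>, so its bound is taken at
    \<open>t / s\<close> and scaled by the square of \<open>s\<close>.\<close>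
  have "s\<^sup>2 * (2 * (t / s) * ?w - (t / s)\<^sup>2 * ?E) \<le> s\<^sup>2 * c n z"
    by (rule mult_left_mono[OF c]) simp
  moreover have "s\<^sup>2 * (2 * (t / s) * ?w - (t / s)\<^sup>2 * ?E) = 2 * t * s * ?w - t\<^sup>2 * ?E"
    using s by (simp add: field_simps power2_eq_square)
  moreover have "2 * t * (1 - s) * ?w - t\<^sup>2 * y * ?w\<^sup>2 \<le> (1 - s)\<^sup>2 / y"
  proof -
    have "0 \<le> ((1 - s) - t * y * ?w)\<^sup>2 / y" using y by simp
    also have "\<dots> = (1 - s)\<^sup>2 / y - (2 * t * (1 - s) * ?w - t\<^sup>2 * y * ?w\<^sup>2)"
      using y by (simp add: field_simps power2_eq_square)
    finally show ?thesis by simp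
  qed
  ultimately have "2 * t * ?w - t\<^sup>2 * (?E + y * ?w\<^sup>2) \<le> g (Suc n) z"
    unfolding g by (simp add: algebra_simps)
  then show ?case by (simp add: y_def algebra_simps)
qed

lemma integral_e: "integrable P (e n)"
  "integral\<^sup>L P (e n) \<le> integral\<^sup>L D (\<lambda>x. x) * (1 + q * m / (m - 1)) * (\<Sum>i<Suc n. rho ^ i)"
proof -
  let ?x = "integral\<^sup>L D (\<lambda>x. x)" and ?K = "1 + q * m / (m - 1)"
  have K: "1 \<le> ?K" using q_nonneg m_gt1 by simp
  have "integrable P (e n) \<and> integral\<^sup>L P (e n) \<le> ?x * ?K * (\<Sum>i<Suc n. rho ^ i)"
  proof (induction n)
    case 0
    have "?x * 1 \<le> ?x * ?K" using K xi_mean_nonneg by (intro mult_left_mono) auto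
    then show ?case using integral_root[OF integrable_xi] by simp
  next
    case (Suc n)
    have eq: "e (Suc n) = (\<lambda>z. avg (e n) z + rho ^ Suc n * (snd (z []) * (W (Suc n) z)\<^sup>2))"
      by auto
    have "integral\<^sup>L P (e (Suc n)) = integral\<^sup>L P (e n) + rho ^ Suc n * (?x * (\<integral>z. (W (Suc n) z)\<^sup>2 \<partial>P))"
      unfolding eq using Suc integral_avg[of "e n"] integral_xi_W_square[of n] by simp
    also have "\<dots> \<le> ?x * ?K * (\<Sum>i<Suc n. rho ^ i) + rho ^ Suc n * (?x * ?K)"
      using Suc rho xi_mean_nonneg integral_W_square(2)[of "Suc n"]
      by (intro add_mono mult_left_mono) auto
    also have "\<dots> = ?x * ?K * (\<Sum>i<Suc (Suc n). rho ^ i)"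
    proof -
      have "x * s + t * x = x * (s + t)" for x s t :: real by algebra
      then show ?thesis unfolding sum.lessThan_Suc[where n = "Suc n"] .
    qed
    finally show ?case
      using Suc integral_avg[of "e n"] integral_xi_W_square[of n] unfolding eq by simp
  qed
  then show "integrable P (e n)" "integral\<^sup>L P (e n) \<le> ?x * ?K * (\<Sum>i<Suc n. rho ^ i)" by auto
qed

text \<open>Integrate the linearised flow bound with \<open>t = 1 / S\<close>, where
  \<open>S\<close> dominates all mean energies: what remains is
  \<open>2 / S - 1 / S\<close>.\<close>

lemma a_lower_bound: "\<exists>\<delta>>0. \<forall>n. \<delta> \<le> a n"
proof -
  \<comment> \<open>The geometric bound on the mean of \<open>e n\<close>; the summand 1 guarantees
    \<open>S > 0\<close>.\<close>
  define S where "S = integral\<^sup>L D (\<lambda>x. x) * (1 + q * m / (m - 1)) * (1 / (1 - rho)) + 1"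
  have K: "0 \<le> integral\<^sup>L D (\<lambda>x. x) * (1 + q * m / (m - 1))"
    using q_nonneg m_gt1 xi_mean_nonneg by simp
  have S: "0 < S" using K rho by (simp add: S_def add_nonneg_pos)
  have geo: "(\<Sum>i<n. rho ^ i) \<le> 1 / (1 - rho)" for n
    using rho by (simp add: sum_gp_strict divide_right_mono)
  have eS: "integral\<^sup>L P (e n) \<le> S" for n
  proof -
    have "integral\<^sup>L P (e n) \<le> integral\<^sup>L D (\<lambda>x. x) * (1 + q * m / (m - 1)) * (1 / (1 - rho))"
      using integral_e(2)[of n] mult_left_mono[OF geo[of "Suc n"] K] by linarith
    then show ?thesis by (simp add: S_def)
  qed
  have "1 / S \<le> a n" for n
  proof -
    have "1 / S = 2 * (1 / S) - (1 / S)\<^sup>2 * S" using S by (simp add: power2_eq_square)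
    also have "\<dots> \<le> 2 * (1 / S) - (1 / S)\<^sup>2 * integral\<^sup>L P (e n)"
      using eS[of n] by (intro diff_left_mono mult_left_mono) auto
    also have "\<dots> = (\<integral>z. 2 * (1 / S) * W n z - (1 / S)\<^sup>2 * e n z \<partial>P)"
      using integral_e(1)[of n] integral_W[of n] by simp
    also have "\<dots> \<le> a n"
      unfolding a_def
    proof (rule integral_mono_AE[OF _ integrable_g])
      show "integrable P (\<lambda>z. 2 * (1 / S) * W n z - (1 / S)\<^sup>2 * e n z)"
        using integral_e(1)[of n] integral_W[of n] by simp
      show "AE z in P. 2 * (1 / S) * W n z - (1 / S)\<^sup>2 * e n z \<le> g n z"
        using AE_pos_config by eventually_elim (rule g_ge_flow)
    qed
    finally show ?thesis .
  qed
  then show ?thesis using S by (intro exI[of _ "1 / S"]) auto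
qed

lemma a_limit: "\<exists>l>0. a \<longlonglongrightarrow> l"
proof -
  obtain \<delta> where \<delta>: "0 < \<delta>" "\<And>n. \<delta> \<le> a n" using a_lower_bound by auto
  obtain l where l: "a \<longlonglongrightarrow> l"
    using decseq_convergent[OF decseq_a] \<delta>(2) by blast
  then have "\<delta> \<le> l" using \<delta>(2) by (intro LIMSEQ_le_const) auto
  then show ?thesis using \<delta>(1) l by (intro exI[of _ l]) auto
qed

section \<open>Approximation by the population size and almost sure convergence\<close>

lemma c_le_iter: "pos_config z \<Longrightarrow> c (j + k) z \<le> iter k (c j) z"
proof (induction k arbitrary: z)
  case (Suc k)
  have "c (j + Suc k) z = avg (g (Suc (j + k))) z" by (simp add: c_eq_avg)
  \<comment> \<open>Replacing \<open>g\<close> by \<open>c\<close> removes the resistance above a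
    vertex; over \<open>k\<close> steps the first \<open>k\<close> generations of edges are
    short-circuited.\<close>
  also have "\<dots> \<le> avg (iter k (c j)) z"
    using g_Suc_bounds(1) Suc.IH by (intro avg_mono Suc.prems) (blast intro: order_trans)
  finally show ?case by simp
qed simp

lemma L1_distance_le:
  "\<exists>K1 K2. \<forall>j k. (\<integral>z. \<bar>c (Suc j + k) z - a (Suc j) * W k z\<bar> \<partial>P) \<le> K1 * rho ^ j + K2 * (1 / sqrt m) ^ k"
proof -
  obtain B where B: "\<And>n. (\<integral>z. (c (Suc n) z)\<^sup>2 \<partial>P) \<le> B" using c_square_bounded by auto
  obtain K where K: "\<And>j k. a (Suc j) - a (Suc j + k) \<le> K * rho ^ j" using a_tail_le by auto
  have "(\<integral>z. \<bar>c (Suc j + k) z - a (Suc j) * W k z\<bar> \<partial>P) \<le> K * rho ^ j + (B + 1) / 2 * (1 / sqrt m) ^ k" for j k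
  proof -
    \<comment> \<open>The centred \<open>c (Suc j)\<close>, with the factor 1 matching
      \<open>iter_diff\<close>. The index starts at \<open>Suc j\<close> because square
      integrability does.\<close>
    define F where "F z = c (Suc j) z - a (Suc j) * 1" for z
    note cj = integral_c[of "Suc j"] integral_c_square(1)[of j]
    have F: "integrable P F" "integral\<^sup>L P F = 0"
      unfolding F_def[abs_def] using cj by (simp_all add: P.prob_space)
    have F2: "integrable P (\<lambda>z. (F z)\<^sup>2)"
      unfolding F_def power2_diff using cj by simp
    have "(\<integral>z. (F z)\<^sup>2 \<partial>P) = (\<integral>z. (c (Suc j) z)\<^sup>2 \<partial>P) - (a (Suc j))\<^sup>2"
      unfolding F_def power2_diff using cj by (simp add: P.prob_space power2_eq_square)
    then have FB: "(\<integral>z. (F z)\<^sup>2 \<partial>P) \<le> B" using B[of j] by (smt (verit) zero_le_power2)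
    have eq: "iter k F z = iter k (c (Suc j)) z - a (Suc j) * W k z" for z
      unfolding F_def W_def by (rule iter_diff)
    let ?T = "iter k (c (Suc j))"
    note T = integral_iter[OF cj(1), of k]
    \<comment> \<open>Triangle inequality through \<open>?T\<close>. By \<open>c_le_iter\<close> the
      first difference is nonnegative, so its L1 norm is just a difference of means.\<close>
    have "(\<integral>z. \<bar>c (Suc j + k) z - a (Suc j) * W k z\<bar> \<partial>P) \<le> (\<integral>z. (?T z - c (Suc j + k) z) + \<bar>iter k F z\<bar> \<partial>P)"
      using AE_pos_config T integral_c[of "Suc j + k"] integral_iter(1)[OF F(1), of k] integral_W[of k]
      by (intro integral_mono_AE)
        (auto elim!: eventually_mono simp: eq dest!: c_le_iter[of _ "Suc j" k])
    also have "\<dots> = (a (Suc j) - a (Suc j + k)) + (\<integral>z. \<bar>iter k F z\<bar> \<partial>P)"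
      using T cj integral_c[of "Suc j + k"] integral_iter(1)[OF F(1), of k] by simp
    also have "\<dots> \<le> K * rho ^ j + (B + 1) / 2 * (1 / sqrt m) ^ k"
      by (intro add_mono K integral_abs_iter_le[OF F(1) F2 F(2) FB])
    finally show ?thesis .
  qed
  then show ?thesis by blast
qed

lemma AE_ratio_tendsto: "AE z in P. (\<lambda>n. c n z / a n) \<longlonglongrightarrow> lim (\<lambda>k. W k z)"
proof -
  obtain K1 K2 where K: "\<And>j k. (\<integral>z. \<bar>c (Suc j + k) z - a (Suc j) * W k z\<bar> \<partial>P)
      \<le> K1 * rho ^ j + K2 * (1 / sqrt m) ^ k"
    using L1_distance_le by blast
  obtain l where l: "0 < l" "a \<longlonglongrightarrow> l" using a_limit by auto
  \<comment> \<open>Both parts of \<open>n\<close> tend to infinity, so both error terms become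
    summable in \<open>n\<close>.\<close>
  define j k where "j n = n div 2" and "k n = n - n div 2" for n :: nat
  have jk: "j n + k n = n" for n by (simp add: j_def k_def)
  have half: "filterlim (\<lambda>n::nat. n div 2) sequentially sequentially"
    unfolding filterlim_at_top eventually_sequentially
    by (intro allI, rule_tac x = "2 * Z" in exI) auto
  then have j: "filterlim j sequentially sequentially" by (simp add: j_def[abs_def])
  have k: "filterlim k sequentially sequentially"
    by (rule filterlim_at_top_mono[OF half], rule always_eventually) (unfold k_def, presburger)
  define F where "F n z = c (Suc n) z - a (Suc (j n)) * W (k n) z" for n z
  have "AE z in P. summable (\<lambda>n. \<bar>F n z\<bar>)"
  proof (rule AE_summable_of_summable_integrals)
    show "integrable P (F n)" for n
      unfolding F_def[abs_def] using integral_c[of "Suc n"] integral_W[of "k n"] by simp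
    show "(\<integral>z. \<bar>F n z\<bar> \<partial>P) \<le> \<bar>K1\<bar> * rho ^ (n div 2) + \<bar>K2\<bar> * (1 / sqrt m) ^ (n div 2)" for n
    proof -
      have "(\<integral>z. \<bar>F n z\<bar> \<partial>P) \<le> K1 * rho ^ j n + K2 * (1 / sqrt m) ^ k n"
        using K[of "j n" "k n"] by (simp add: jk F_def)
      also have "\<dots> \<le> \<bar>K1\<bar> * rho ^ j n + \<bar>K2\<bar> * (1 / sqrt m) ^ k n"
        using rho m_pos by (intro add_mono mult_right_mono) auto
      also have "\<dots> \<le> \<bar>K1\<bar> * rho ^ (n div 2) + \<bar>K2\<bar> * (1 / sqrt m) ^ (n div 2)"
        using rho m_gt1 unfolding j_def k_def by (intro add_mono mult_left_mono power_decreasing) auto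
      finally show ?thesis .
    qed
    show "summable (\<lambda>n. \<bar>K1\<bar> * rho ^ (n div 2) + \<bar>K2\<bar> * (1 / sqrt m) ^ (n div 2))"
      using rho m_gt1 by (intro summable_add summable_mult summable_power_half) auto
  qed
  with AE_convergent_W show ?thesis
  proof eventually_elim
    case (elim z)
    have W: "(\<lambda>k. W k z) \<longlonglongrightarrow> lim (\<lambda>k. W k z)"
      using elim(1) by (simp add: convergent_LIMSEQ_iff)
    have "(\<lambda>n. F n z) \<longlonglongrightarrow> 0"
      using summable_LIMSEQ_zero[OF elim(2)] by (simp add: tendsto_rabs_zero_iff)
    moreover have "(\<lambda>n. a (Suc (j n)) * W (k n) z) \<longlonglongrightarrow> l * lim (\<lambda>k. W k z)"
      using filterlim_compose[OF LIMSEQ_Suc[OF l(2)] j] filterlim_compose[OF W k]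
      by (rule tendsto_mult)
    ultimately have "(\<lambda>n. F n z + a (Suc (j n)) * W (k n) z) \<longlonglongrightarrow> 0 + l * lim (\<lambda>k. W k z)"
      by (rule tendsto_add)
    then have "(\<lambda>n. c (Suc n) z) \<longlonglongrightarrow> l * lim (\<lambda>k. W k z)" by (simp add: F_def)
    then have "(\<lambda>n. c n z) \<longlonglongrightarrow> l * lim (\<lambda>k. W k z)" by (rule LIMSEQ_imp_Suc)
    \<comment> \<open>Dividing by the means uses that their limit \<open>l\<close> is
      nonzero.\<close>
    then have "(\<lambda>n. c n z / a n) \<longlonglongrightarrow> l * lim (\<lambda>k. W k z) / l"
      using l by (intro tendsto_divide) auto
    then show ?case using l(1) by simp
  qed
qed

end

section \<open>Measurability of the effective conductance\<close>

text \<open>On the reals \<open>Inf\<close> is defined from the lower bounds of a set alone, so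
  equality holds even when there are none.\<close>

lemma Inf_real_cong:
  fixes S T :: "real set"
  assumes "\<And>y. (\<forall>x\<in>S. y \<le> x) \<longleftrightarrow> (\<forall>x\<in>T. y \<le> x)"
  shows "Inf S = Inf T"
proof -
  have "(\<forall>x\<in>uminus ` S. x \<le> z) \<longleftrightarrow> (\<forall>x\<in>uminus ` T. x \<le> z)" for z
    using assms[of "- z"] by auto
  then show ?thesis unfolding Inf_real_def Sup_real_def by simp
qed

text \<open>On the set where the family is unbounded below, \<^const>\<open>Inf\<close> takes one fixed
  unspecified value.\<close>

lemma borel_measurable_Inf_countable:
  fixes f :: "'i :: countable \<Rightarrow> 'a \<Rightarrow> real"
  assumes [measurable]: "\<And>i. f i \<in> borel_measurable N"
  shows "(\<lambda>z. Inf (range (\<lambda>i. f i z))) \<in> borel_measurable N"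
proof -
  define B where "B z \<longleftrightarrow> (\<exists>k::nat. \<forall>i. - real k \<le> f i z)" for z
  have B: "B z \<longleftrightarrow> bdd_below (range (\<lambda>i. f i z))" for z
  proof
    assume "bdd_below (range (\<lambda>i. f i z))"
    then obtain y where y: "\<And>i. y \<le> f i z" by (auto simp: bdd_below_def)
    obtain k where "- y < real k" using reals_Archimedean2 by blast
    then show "B z" unfolding B_def using y by (intro exI[of _ k]) (smt (verit))
  qed (auto simp: B_def bdd_below_def)
  have [measurable]: "Measurable.pred N B" unfolding B_def by measurable
  \<comment> \<open>Cut off outside \<open>B\<close>, the family is bounded below
    everywhere.\<close>
  define h where "h i z = (if B z then f i z else 0)" for i z
  have "(\<lambda>z. INF i. h i z) \<in> borel_measurable N"
  proof (rule borel_measurable_cINF)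
    show "bdd_below ((\<lambda>i. h i z) ` UNIV)" for z
      using B[of z] by (cases "B z") (auto simp: h_def)
  qed (auto simp: h_def)
  moreover have "Inf (range (\<lambda>i. f i z)) = (if B z then INF i. h i z else Inf UNIV)" for z
  proof (cases "B z")
    case False
    then have "\<not> (\<forall>x\<in>range (\<lambda>i. f i z). y \<le> x)" for y
      using B[of z] by (auto simp: bdd_below_def)
    moreover have "\<not> (\<forall>x\<in>UNIV. y \<le> x)" for y :: real
      using lt_ex[of y] by (auto simp: not_le)
    ultimately have "Inf (range (\<lambda>i. f i z)) = Inf UNIV" by (intro Inf_real_cong) blast
    with False show ?thesis by simp
  qed (simp add: h_def)
  ultimately show ?thesis by simp
qed

text \<open>Imposes the boundary values on an arbitrary function, turning the constrained infimum
  into one over a range.\<close>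

definition clamp_potential :: "nat \<Rightarrow> (nat list \<Rightarrow> real) \<Rightarrow> nat list \<Rightarrow> real" where
  "clamp_potential n h v = (if v = [] then 1 else if n \<le> length v then 0 else h v)"

text \<open>Finitely supported rational potentials, coded by lists to obtain a countable index
  type.\<close>

definition rat_potential :: "(nat list \<times> rat) list \<Rightarrow> nat list \<Rightarrow> real" where
  "rat_potential l v = (case map_of l v of None \<Rightarrow> 0 | Some r \<Rightarrow> of_rat r)"

text \<open>Clamping an admissible potential changes it only at vertices that the energy does not
  see.\<close>

lemma eff_conductance_clamp:
  "eff_conductance lam N X (Suc n) =
     Inf (range (\<lambda>h. dirichlet_energy lam N X (Suc n) (clamp_potential (Suc n) h)))"
proof -
  have "dirichlet_energy lam N X (Suc n) f = dirichlet_energy lam N X (Suc n) (clamp_potential (Suc n) f)"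
    if f: "f [] = 1" "\<forall>v\<in>gw_level N (Suc n). f v = 0" for f
    unfolding dirichlet_energy_def
  proof (intro sum.cong refl)
    fix v assume v: "v \<in> {v \<in> gw_tree N. 1 \<le> length v \<and> length v \<le> Suc n}"
    then have "clamp_potential (Suc n) f v = f v"
      using f by (auto simp: clamp_potential_def gw_level_def)
    moreover have "clamp_potential (Suc n) f (butlast v) = f (butlast v)"
      using v f(1) by (auto simp: clamp_potential_def)
    ultimately show "(f (butlast v) - f v)\<^sup>2 / (lam ^ length v * X v) =
      (clamp_potential (Suc n) f (butlast v) - clamp_potential (Suc n) f v)\<^sup>2 / (lam ^ length v * X v)"
      by simp
  qed
  moreover have "clamp_potential (Suc n) h [] = 1"
    "\<forall>v\<in>gw_level N (Suc n). clamp_potential (Suc n) h v = 0" for h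
    by (auto simp: clamp_potential_def gw_level_def)
  ultimately have "{dirichlet_energy lam N X (Suc n) f | f. f [] = 1 \<and> (\<forall>v \<in> gw_level N (Suc n). f v = 0)}
      = range (\<lambda>h. dirichlet_energy lam N X (Suc n) (clamp_potential (Suc n) h))"
    by blast
  then show ?thesis by (simp add: eff_conductance_def)
qed

lemma rat_potential_dense:
  "\<exists>l. (\<lambda>k. dirichlet_energy lam N X n (clamp_potential n (rat_potential (l k))))
     \<longlonglongrightarrow> dirichlet_energy lam N X n (clamp_potential n h)"
proof -
  \<comment> \<open>The finitely many vertices on which the energy depends; on them it is continuous
    in the potential.\<close>
  define S where "S = gw_edges N n \<union> butlast ` gw_edges N n"
  have "finite S" by (simp add: S_def finite_gw_edges)
  then obtain vs where vs: "set vs = S" using finite_list by blast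
  have ex: "\<exists>r. h v < of_rat r \<and> of_rat r < h v + inverse (real (Suc k))" for k v
    by (rule of_rat_dense) simp
  define R where "R k v = (SOME r. h v < of_rat r \<and> of_rat r < h v + inverse (real (Suc k)))" for k v
  have R: "h v < of_rat (R k v)" "of_rat (R k v) < h v + inverse (real (Suc k))" for k v
    using someI_ex[OF ex[of v k]] by (simp_all add: R_def)
  define l where "l k = map (\<lambda>v. (v, R k v)) vs" for k
  have rl: "rat_potential (l k) v = of_rat (R k v)" if "v \<in> S" for k v
    using that by (simp add: rat_potential_def l_def map_of_map_restrict restrict_map_def vs)
  have lim: "(\<lambda>k. rat_potential (l k) v) \<longlonglongrightarrow> h v" if "v \<in> S" for v
  proof (rule tendsto_sandwich)
    show "(\<lambda>_. h v) \<longlonglongrightarrow> h v" by simp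
    show "(\<lambda>k. h v + inverse (real (Suc k))) \<longlonglongrightarrow> h v"
      using tendsto_add[OF tendsto_const LIMSEQ_inverse_real_of_nat] by simp
  qed (use R that in \<open>auto simp: rl intro!: always_eventually less_imp_le simp del: of_nat_Suc\<close>)
  have "(\<lambda>k. clamp_potential n (rat_potential (l k)) v) \<longlonglongrightarrow> clamp_potential n h v" if "v \<in> S" for v
    using lim[OF that] by (simp add: clamp_potential_def)
  then have "(\<lambda>k. dirichlet_energy lam N X n (clamp_potential n (rat_potential (l k))))
     \<longlonglongrightarrow> dirichlet_energy lam N X n (clamp_potential n h)"
    unfolding dirichlet_energy_def gw_edges_def[symmetric] divide_inverse
    by (intro tendsto_sum tendsto_mult_right tendsto_power tendsto_diff) (auto simp: S_def)
  then show ?thesis by blast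
qed

text \<open>Lower bounds pass to limits, so by density both families of energies have the same lower
  bounds.\<close>

lemma eff_conductance_eq_Inf_rat:
  "eff_conductance lam N X (Suc n) =
     Inf (range (\<lambda>l. dirichlet_energy lam N X (Suc n) (clamp_potential (Suc n) (rat_potential l))))"
  unfolding eff_conductance_clamp
proof (rule Inf_real_cong)
  fix y
  let ?E = "\<lambda>h. dirichlet_energy lam N X (Suc n) (clamp_potential (Suc n) h)"
  have "y \<le> ?E h" if y: "\<And>l. y \<le> ?E (rat_potential l)" for h
  proof -
    obtain l where "(\<lambda>k. ?E (rat_potential (l k))) \<longlonglongrightarrow> ?E h"
      using rat_potential_dense by blast
    then show ?thesis using y by (intro LIMSEQ_le_const) auto
  qed
  then show "(\<forall>x\<in>range ?E. y \<le> x) \<longleftrightarrow> (\<forall>x\<in>range (\<lambda>l. ?E (rat_potential l)). y \<le> x)"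
    by blast
qed

context gw_law
begin

lemma measurable_random_sum_root:
  fixes F :: "nat \<Rightarrow> config \<Rightarrow> real"
  assumes [measurable]: "\<And>i. F i \<in> borel_measurable P"
  shows "(\<lambda>z. \<Sum>i<fst (z []). F i z) \<in> borel_measurable P"
proof -
  have "(\<lambda>z. \<Sum>i<k. F i z) \<in> borel_measurable P" for k
    by measurable
  then show ?thesis
    by (rule measurable_compose_countable) (rule measurable_fst_root)
qed

lemma measurable_energy: "(\<lambda>z. energy lam z n f) \<in> borel_measurable P"
proof (induction n arbitrary: f)
  case (Suc n)
  have "(\<lambda>z. energy lam (subtree i z) n (subtree i f)) \<in> borel_measurable P" for i
    by (rule measurable_compose[OF subtree_measurable Suc])
  moreover have "(\<lambda>z. snd (subtree i z [])) \<in> borel_measurable P" for i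
    by (rule measurable_compose[OF subtree_measurable measurable_snd_root])
  then have "(\<lambda>z. (f [] - f [i])\<^sup>2 / snd (z [i])) \<in> borel_measurable P" for i
    by simp
  ultimately have "(\<lambda>z. \<Sum>i<fst (z []). (f [] - f [i])\<^sup>2 / snd (z [i])
      + energy lam (subtree i z) n (subtree i f)) \<in> borel_measurable P"
    by (intro measurable_random_sum_root borel_measurable_add)
  then show ?case unfolding energy_Suc by simp
qed simp

lemma measurable_eff_conductance:
  "(\<lambda>z. eff_conductance lam (\<lambda>u. fst (z u)) (\<lambda>u. snd (z u)) (Suc n)) \<in> borel_measurable P"
  unfolding eff_conductance_eq_Inf_rat by (intro borel_measurable_Inf_countable measurable_energy)

end

section \<open>The limit theorem\<close>

context gw_network
begin

abbreviation cond :: "nat \<Rightarrow> config \<Rightarrow> real" where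
  "cond n z \<equiv> eff_conductance lam (\<lambda>u. fst (z u)) (\<lambda>u. snd (z u)) n"

text \<open>Only positive levels occur: at level 0 the root would need both potentials 1 and 0, and
  \<open>Inf\<close> is taken over the empty set.\<close>

lemma cond_eq: "pos_config z \<Longrightarrow> cond (Suc n) z = rho ^ Suc n * c n z"
  using rho by (simp add: eff_conductance_eq_root_cond[OF lam_pos] c_def)

lemma integral_cond: "integral\<^sup>L P (cond (Suc n)) = rho ^ Suc n * a n"
proof -
  have "integral\<^sup>L P (cond (Suc n)) = (\<integral>z. rho ^ Suc n * c n z \<partial>P)"
    using AE_pos_config
    by (intro integral_cong_AE measurable_eff_conductance)
      (auto elim!: eventually_mono simp: cond_eq simp del: power_Suc)
  then show ?thesis using integral_c by simp
qed

lemma AE_cond_ratio: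
  "AE z in P. (\<lambda>n. cond n z / integral\<^sup>L P (cond n))
     \<longlonglongrightarrow> lim (\<lambda>n. real (card (gw_level (\<lambda>u. fst (z u)) n)) / m ^ n)"
  using AE_ratio_tendsto AE_pos_config
proof eventually_elim
  case (elim z)
  have "cond (Suc n) z / integral\<^sup>L P (cond (Suc n)) = c n z / a n" for n
    using rho by (simp add: cond_eq[OF elim(2)] integral_cond)
  then have "(\<lambda>n. cond (Suc n) z / integral\<^sup>L P (cond (Suc n))) \<longlonglongrightarrow> lim (\<lambda>k. W k z)"
    using elim(1) by simp
  \<comment> \<open>Passing back from \<open>Suc n\<close> to \<open>n\<close> discards the
    degenerate level 0.\<close>
  then show ?case unfolding W_eq_card by (rule LIMSEQ_imp_Suc)
qed

lemma integral_cond_limit: "\<exists>L>0. (\<lambda>n. (lam / m) ^ n * integral\<^sup>L P (cond n)) \<longlonglongrightarrow> L"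
proof -
  obtain l where l: "0 < l" "a \<longlonglongrightarrow> l" using a_limit by auto
  have "(lam / m) ^ Suc n * integral\<^sup>L P (cond (Suc n)) = a n" for n
  proof -
    have "(lam / m) ^ Suc n * rho ^ Suc n = 1"
      using lam_pos m_pos unfolding power_mult_distrib[symmetric] by (simp add: rho_def)
    then show ?thesis unfolding integral_cond by (metis mult.assoc mult_1)
  qed
  then have "(\<lambda>n. (lam / m) ^ Suc n * integral\<^sup>L P (cond (Suc n))) \<longlonglongrightarrow> l"
    using l(2) by simp
  then have "(\<lambda>n. (lam / m) ^ n * integral\<^sup>L P (cond n)) \<longlonglongrightarrow> l" by (rule LIMSEQ_imp_Suc)
  then show ?thesis using l(1) by auto
qed

end

section \<open>Transfer from the canonical space to a given family of labels\<close>

theorem theorem7p1: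
  fixes M :: "'w measure"
    and p :: "nat pmf"
    and D :: "real measure"
    and Z :: "nat list \<Rightarrow> 'w \<Rightarrow> nat \<times> real"
    and lam :: real
  defines "m \<equiv> measure_pmf.expectation p real"
  defines "C \<equiv> (\<lambda>n w. eff_conductance lam (\<lambda>u. fst (Z u w)) (\<lambda>u. snd (Z u w)) n)"
  defines "W \<equiv> (\<lambda>w. lim (\<lambda>n. real (card (gw_level (\<lambda>u. fst (Z u w)) n)) / m ^ n))"
  assumes M: "prob_space M"
    and p0: "pmf p 0 = 0"
    and mean_fin: "integrable (measure_pmf p) real"
    and m_gt1: "m > 1"
    and D: "prob_space D" "sets D = sets borel"
    and xi_pos: "AE x in D. 0 < x"
    and indep: "prob_space.indep_vars M (\<lambda>_. count_space UNIV \<Otimes>\<^sub>M borel) Z UNIV"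
    and distr: "\<And>u. distr M (count_space UNIV \<Otimes>\<^sub>M borel) (Z u) = measure_pmf p \<Otimes>\<^sub>M D"
    and lam: "lam > m"
  shows "((integrable D (\<lambda>x. x) \<and> integrable D (\<lambda>x. 1 / x)
            \<and> integrable (measure_pmf p) (\<lambda>k. real k ^ 2))
         \<longrightarrow> (AE w in M. (\<lambda>n. C n w / integral\<^sup>L M (C n)) \<longlonglongrightarrow> W w))
       \<and> ((integrable D (\<lambda>x. x ^ 2) \<and> integrable D (\<lambda>x. 1 / x)
            \<and> integrable (measure_pmf p) (\<lambda>k. real k ^ 3))
         \<longrightarrow> (\<exists>L > 0. (\<lambda>n. (lam / m) ^ n * integral\<^sup>L M (C n)) \<longlonglongrightarrow> L))"
proof -
  interpret M: prob_space M by (rule M)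
  interpret D: prob_space D by (rule D(1))
  interpret G: gw_law p D m
    by unfold_locales (simp_all add: D m_def mean_fin m_gt1[unfolded m_def])
  let ?N = "count_space UNIV \<Otimes>\<^sub>M borel :: (nat \<times> real) measure"
  let ?\<Phi> = "\<lambda>w u. Z u w"
  have setsL: "sets G.L = sets ?N"
    unfolding G.L_def by (intro sets_pair_measure_cong) (simp_all add: D(2))
  have setsP: "sets G.P = sets (PiM UNIV (\<lambda>_. ?N))"
    unfolding G.P_def by (intro sets_PiM_cong refl setsL)
  have Z: "Z u \<in> M \<rightarrow>\<^sub>M ?N" for u using indep by (simp add: M.indep_vars_def)
  have \<Phi>: "?\<Phi> \<in> M \<rightarrow>\<^sub>M G.P"
    unfolding measurable_cong_sets[OF refl setsP]
    by (rule measurable_PiM_single') (use Z in \<open>auto simp: space_pair_measure\<close>)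
  \<comment> \<open>Independence and the common label law say that the random configuration has law
    \<open>G.P\<close>, so almost sure statements and integrals carry over.\<close>
  have law: "distr M G.P ?\<Phi> = G.P"
  proof -
    have "distr M G.P ?\<Phi> = distr M (PiM UNIV (\<lambda>_. ?N)) (\<lambda>w. \<lambda>u\<in>UNIV. Z u w)"
      by (intro distr_cong) (auto simp: setsP)
    also have "\<dots> = G.P"
      using indep Z by (subst (asm) M.indep_vars_iff_distr_eq_PiM) (auto simp: distr G.P_def G.L_def)
    finally show ?thesis .
  qed
  let ?c = "\<lambda>n z. eff_conductance lam (\<lambda>u. fst (z u)) (\<lambda>u. snd (z u)) n"
  have C: "C n = (\<lambda>w. ?c n (?\<Phi> w))" for n by (simp add: C_def)
  have int_C: "integral\<^sup>L M (C (Suc n)) = integral\<^sup>L G.P (?c (Suc n))" for n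
    using integral_distr[OF \<Phi> G.measurable_eff_conductance[of lam n]] unfolding law C by simp
  have network: "gw_network p D m lam"
    if "integrable D (\<lambda>x. x)" "integrable D (\<lambda>x. 1 / x)" "integrable (measure_pmf p) (\<lambda>k. real k ^ 2)"
    by unfold_locales (use that lam xi_pos in auto)
  show ?thesis
  proof (intro conjI impI)
    assume as: "integrable D (\<lambda>x. x) \<and> integrable D (\<lambda>x. 1 / x)
            \<and> integrable (measure_pmf p) (\<lambda>k. real k ^ 2)"
    then interpret N: gw_network p D m lam by (intro network) auto
    have "AE w in M. (\<lambda>n. ?c n (?\<Phi> w) / integral\<^sup>L G.P (?c n)) \<longlonglongrightarrow> W w"
      using AE_distrD[OF \<Phi>, unfolded law, OF N.AE_cond_ratio] by (simp add: W_def)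
    then show "AE w in M. (\<lambda>n. C n w / integral\<^sup>L M (C n)) \<longlonglongrightarrow> W w"
    proof eventually_elim
      case (elim w)
      have "(\<lambda>n. C (Suc n) w / integral\<^sup>L M (C (Suc n))) \<longlonglongrightarrow> W w"
        using LIMSEQ_Suc[OF elim] unfolding int_C by (simp add: C_def)
      then show ?case by (rule LIMSEQ_imp_Suc)
    qed
  next
    assume as: "integrable D (\<lambda>x. x ^ 2) \<and> integrable D (\<lambda>x. 1 / x)
            \<and> integrable (measure_pmf p) (\<lambda>k. real k ^ 3)"
    \<comment> \<open>The second set of moment conditions implies the first: on a probability space
      square integrability gives integrability, and \<open>k^2 <= k^3\<close> for natural
      \<open>k\<close>.\<close>
    have "integrable D (\<lambda>x. x)"
    proof (rule D.square_integrable_imp_integrable)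
      show "(\<lambda>x. x) \<in> borel_measurable D"
        unfolding measurable_cong_sets[OF D(2) refl] by simp
    qed (use as in simp)
    moreover have "integrable (measure_pmf p) (\<lambda>k. real k ^ 2)"
    proof (rule Bochner_Integration.integrable_bound)
      show "integrable (measure_pmf p) (\<lambda>k. real k ^ 3)" using as by simp
      have "real k ^ 2 \<le> real k ^ 3" for k
        by (cases "k = 0") (auto intro: power_increasing)
      then show "AE k in measure_pmf p. norm (real k ^ 2) \<le> norm (real k ^ 3)" by auto
    qed simp
    ultimately interpret N: gw_network p D m lam using as by (intro network) auto
    obtain L where L: "0 < L" "(\<lambda>n. (lam / m) ^ n * integral\<^sup>L G.P (?c n)) \<longlonglongrightarrow> L"
      using N.integral_cond_limit by auto
    have "(\<lambda>n. (lam / m) ^ Suc n * integral\<^sup>L M (C (Suc n))) \<longlonglongrightarrow> L"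
      unfolding int_C using L(2) by (rule LIMSEQ_Suc)
    then have "(\<lambda>n. (lam / m) ^ n * integral\<^sup>L M (C n)) \<longlonglongrightarrow> L" by (rule LIMSEQ_imp_Suc)
    then show "\<exists>L > 0. (\<lambda>n. (lam / m) ^ n * integral\<^sup>L M (C n)) \<longlonglongrightarrow> L"
      using L(1) by auto
  qed
qed

end
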